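(* Let $G=\star_{i\in I}G_i$ be the free product of a finite family of finite groups, with $|I|\ge 2$ and $|G_i|>1$ for all $i$. Let $\mu$ be a probability measure on $\Sigma=\bigsqcup_i\Sigma_i$, $\Sigma_i=G_i\setminus\{1_{G_i}\}$. Assume that $\bigcup_{n\ge1}\mathrm{supp}\,\mu^{*n}=G$ and that the random walk $(G,\mu)$ is transient. Then the Traffic Equations $$x(a)=\mu(a)\sum_{u\in\Sigma\setminus\Sigma_a}x(u)+\sum_{(u,v)\in\Sigma^2,\ u\ast v=a}\mu(u)x(v)+\sum_{u\in\Sigma\setminus\Sigma_a}\mu(u^{-1})\frac{x(u)}{\sum_{v\in\Sigma\setminus\Sigma_u}x(v)}\,x(a),\qquad a\in\Sigma,$$ have a unique solution $r\in\mathring{\mathcal B}=\{x\in\mathbb R^\Sigma: x(u)>0\ \forall u,\ \sum_u x(u)=1\}$, and the harmonic measure of the random walk $(G,\mu)$ is the Markovian multiplicative measure associated with $r$.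
   Context: For $a\in\Sigma$ write $\Sigma_a=\Sigma_i$ where $i$ is the index with $a\in\Sigma_i$. Elements of $G$ are identified with the set $L$ of finite words $u_1\cdots u_k$ over $\Sigma$ whose consecutive letters lie in different $\Sigma_i$'s (empty word $=1$). $L^\infty\subset\Sigma^{\mathbb N}$ is the set of infinite words all of whose finite prefixes lie in $L$. $u\Sigma^{\mathbb N}$ denotes the cylinder of infinite words with prefix $u$. For $x\in\mathbb R^\Sigma$ and $S\subset\Sigma$, $x(S)=\sum_{u\in S}x(u)$. Random walk $(G,\mu)$: $X_0=1$, $X_{n+1}=X_n\ast x_n$ with $(x_n)$ i.i.d. of law $\mu$. Under the assumptions, there is a.s. a random $X_\infty\in L^\infty$ such that the length of the common prefix of $X_n$ and $X_\infty$ tends to infinity; the harmonic measure $\mu^\infty$ is the law of $X_\infty$. For $r\in\mathring{\mathcal B}$, the Markovian multiplicative measure associated with $r$ is the probability measure $\nu^\infty$ on $L^\infty$ with, for every nonempty $u_1\cdots u_k\in L$, $$\nu^\infty(u_1\cdots u_k\Sigma^{\mathbb N})=\frac{r(u_1)}{r(\Sigma\setminus\Sigma_{u_1})}\cdots\frac{r(u_{k-1})}{r(\Sigma\setminus\Sigma_{u_{k-1}})}\,r(u_k).$$ *)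

theory Defs
  imports "HOL-Probability.Probability" "HOL-Algebra.Group" "HOL-Library.Sublist"
begin

section \<open>Free products, as groups of reduced words\<close>

text \<open>A letter is a pair of an index \<open>i\<close> and a non-neutral element of \<open>G i\<close>, so that the
  alphabet is the disjoint union of the sets \<open>\<Sigma>\<^sub>i = G\<^sub>i - {1}\<close>.\<close>

definition alphabet :: "'i set \<Rightarrow> ('i \<Rightarrow> ('a, 'b) monoid_scheme) \<Rightarrow> ('i \<times> 'a) set" where
  "alphabet I G = (SIGMA i:I. carrier (G i) - {\<one>\<^bsub>G i\<^esub>})"

definition letters_like ::
    "'i set \<Rightarrow> ('i \<Rightarrow> ('a, 'b) monoid_scheme) \<Rightarrow> 'i \<times> 'a \<Rightarrow> ('i \<times> 'a) set" where
  "letters_like I G a = {b \<in> alphabet I G. fst b = fst a}"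

definition letter_inv :: "('i \<Rightarrow> ('a, 'b) monoid_scheme) \<Rightarrow> 'i \<times> 'a \<Rightarrow> 'i \<times> 'a" where
  "letter_inv G a = (fst a, inv\<^bsub>G (fst a)\<^esub> (snd a))"

definition reduced_words ::
    "'i set \<Rightarrow> ('i \<Rightarrow> ('a, 'b) monoid_scheme) \<Rightarrow> ('i \<times> 'a) list set" where
  "reduced_words I G = {w. set w \<subseteq> alphabet I G \<and> distinct_adj (map fst w)}"

text \<open>For \<open>w\<close> reduced, \<open>cons_letter G a w\<close> is the reduced form of \<open>a # w\<close>; a single cancellation or
  merge suffices because the next letter of \<open>w\<close> has a different index.\<close>

fun cons_letter ::
    "('i \<Rightarrow> ('a, 'b) monoid_scheme) \<Rightarrow> 'i \<times> 'a \<Rightarrow> ('i \<times> 'a) list \<Rightarrow> ('i \<times> 'a) list" where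
  "cons_letter G (i, g) [] = [(i, g)]"
| "cons_letter G (i, g) ((j, h) # w) =
     (if i = j
      then (if g \<otimes>\<^bsub>G i\<^esub> h = \<one>\<^bsub>G i\<^esub> then w else (i, g \<otimes>\<^bsub>G i\<^esub> h) # w)
      else (i, g) # (j, h) # w)"

definition free_product ::
    "'i set \<Rightarrow> ('i \<Rightarrow> ('a, 'b) monoid_scheme) \<Rightarrow> ('i \<times> 'a) list monoid" where
  "free_product I G =
     \<lparr>carrier = reduced_words I G, mult = foldr (cons_letter G), one = []\<rparr>"

lemma cons_letter_closed:
  assumes G: "\<forall>i\<in>I. group (G i)"
    and a: "a \<in> alphabet I G" and w: "w \<in> reduced_words I G"
  shows "cons_letter G a w \<in> reduced_words I G"
proof -
  obtain i g where [simp]: "a = (i, g)" by fastforce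
  have ig: "i \<in> I" "g \<in> carrier (G i)" "g \<noteq> \<one>\<^bsub>G i\<^esub>"
    using a by (auto simp: alphabet_def)
  interpret group "G i" using G ig by blast
  show ?thesis
  proof (cases w)
    case Nil
    then show ?thesis using a by (simp add: reduced_words_def)
  next
    case (Cons b v)
    obtain j h where [simp]: "b = (j, h)" by fastforce
    show ?thesis
      using w a ig Cons
      by (cases v)
        (auto simp: reduced_words_def alphabet_def distinct_adj_Cons
          intro!: monoid.m_closed group.is_monoid G[rule_format])
  qed
qed

lemma foldr_cons_letter_closed:
  assumes "\<forall>i\<in>I. group (G i)"
    and "set u \<subseteq> alphabet I G" and "w \<in> reduced_words I G"
  shows "foldr (cons_letter G) u w \<in> reduced_words I G"
  using assms(2) by (induction u) (auto intro!: cons_letter_closed assms(1,3))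

lemma cons_letter_same_index:
  assumes G: "\<forall>i\<in>I. group (G i)"
    and a: "(i, g) \<in> alphabet I G" "(i, h) \<in> alphabet I G" and w: "w \<in> reduced_words I G"
  shows "cons_letter G (i, g) (cons_letter G (i, h) w) =
    (if g \<otimes>\<^bsub>G i\<^esub> h = \<one>\<^bsub>G i\<^esub> then w else cons_letter G (i, g \<otimes>\<^bsub>G i\<^esub> h) w)"
proof -
  have ig: "i \<in> I" "g \<in> carrier (G i)" "g \<noteq> \<one>\<^bsub>G i\<^esub>" "h \<in> carrier (G i)" "h \<noteq> \<one>\<^bsub>G i\<^esub>"
    using a by (auto simp: alphabet_def)
  interpret group "G i" using G ig by blast
  show ?thesis
  proof (cases w)
    case Nil
    then show ?thesis by simp
  next
    case (Cons b v)
    obtain j k where b: "b = (j, k)" by fastforce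
    show ?thesis
    proof (cases "i = j")
      case False
      then show ?thesis using Cons b by simp
    next
      case True
      have k: "k \<in> carrier (G i)" "k \<noteq> \<one>\<^bsub>G i\<^esub>"
        using w Cons b True by (auto simp: reduced_words_def alphabet_def)
      have v: "cons_letter G (i, x) v = (i, x) # v" for x
      proof (cases v)
        case (Cons c v')
        moreover obtain l m where "c = (l, m)" by fastforce
        ultimately show ?thesis
          using w \<open>w = b # v\<close> b True by (auto simp: reduced_words_def)
      qed simp
      have assoc: "g \<otimes>\<^bsub>G i\<^esub> (h \<otimes>\<^bsub>G i\<^esub> k) = g \<otimes>\<^bsub>G i\<^esub> h \<otimes>\<^bsub>G i\<^esub> k"
        using ig k by (simp add: m_assoc)
      show ?thesis
      proof (cases "h \<otimes>\<^bsub>G i\<^esub> k = \<one>\<^bsub>G i\<^esub>")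
        case hk: True
        then have "g \<otimes>\<^bsub>G i\<^esub> h \<otimes>\<^bsub>G i\<^esub> k = g" using assoc ig by simp
        moreover have "g = k" if "g \<otimes>\<^bsub>G i\<^esub> h = \<one>\<^bsub>G i\<^esub>"
          using calculation that k by simp
        ultimately show ?thesis
          using Cons b True hk v ig by auto
      next
        case False
        then show ?thesis
          using Cons b True assoc k l_one[OF k(1)] by auto
      qed
    qed
  qed
qed

lemma foldr_cons_letter_assoc:
  assumes G: "\<forall>i\<in>I. group (G i)"
    and "set u \<subseteq> alphabet I G" "v \<in> reduced_words I G" "w \<in> reduced_words I G"
  shows "foldr (cons_letter G) (foldr (cons_letter G) u v) w =
    foldr (cons_letter G) u (foldr (cons_letter G) v w)"
proof -
  have step: "foldr (cons_letter G) (cons_letter G a v) w =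
      cons_letter G a (foldr (cons_letter G) v w)"
    if a: "a \<in> alphabet I G" and v: "v \<in> reduced_words I G" for a v
  proof (cases v)
    case Nil
    then show ?thesis by (cases a) simp
  next
    case (Cons b v')
    obtain i g j h where [simp]: "a = (i, g)" "b = (j, h)" by fastforce
    show ?thesis
    proof (cases "i = j")
      case False
      then show ?thesis using Cons by simp
    next
      case True
      have "(i, h) \<in> alphabet I G" "set v' \<subseteq> alphabet I G"
        using v Cons True by (auto simp: reduced_words_def)
      moreover from this have "foldr (cons_letter G) v' w \<in> reduced_words I G"
        using foldr_cons_letter_closed[OF G] assms(4) by blast
      ultimately show ?thesis
        using cons_letter_same_index[OF G, where i = i and g = g and h = h and w = "foldr (cons_letter G) v' w"] a Cons True
        by auto
    qed
  qed
  show ?thesis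
    using assms(2)
    by (induction u) (simp_all add: step foldr_cons_letter_closed[OF G] assms(3))
qed

lemma foldr_cons_letter_Nil:
  "w \<in> reduced_words I G \<Longrightarrow> foldr (cons_letter G) w [] = w"
proof (induction w)
  case (Cons a w)
  have "w \<in> reduced_words I G"
    using Cons.prems by (cases w) (auto simp: reduced_words_def)
  then have "foldr (cons_letter G) (a # w) [] = cons_letter G a w"
    using Cons.IH by simp
  also have "\<dots> = a # w"
  proof (cases w)
    case Nil
    then show ?thesis by (cases a) simp
  next
    case (Cons b v)
    then show ?thesis
      using \<open>a # w \<in> reduced_words I G\<close> by (cases a; cases b) (simp add: reduced_words_def)
  qed
  finally show ?case .
qed simp

theorem group_free_product:
  assumes G: "\<forall>i\<in>I. group (G i)"
  shows "group (free_product I G)"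
proof (rule groupI)
  fix u assume "u \<in> carrier (free_product I G)"
  then have u: "u \<in> reduced_words I G" by (simp add: free_product_def)
  have cancel: "letter_inv G a \<in> alphabet I G" "cons_letter G (letter_inv G a) (cons_letter G a w) = w"
    if a: "a \<in> alphabet I G" and w: "w \<in> reduced_words I G" for a w
  proof -
    obtain i g where ig: "a = (i, g)" "i \<in> I" "g \<in> carrier (G i)" "g \<noteq> \<one>\<^bsub>G i\<^esub>"
      using a by (auto simp: alphabet_def)
    interpret group "G i" using G ig by blast
    show *: "letter_inv G a \<in> alphabet I G"
      using ig by (auto simp: alphabet_def letter_inv_def inv_eq_1_iff)
    show "cons_letter G (letter_inv G a) (cons_letter G a w) = w"
      using cons_letter_same_index[OF G, where i = i and g = "inv\<^bsub>G i\<^esub> g" and h = g and w = w] * a w ig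
      by (simp add: letter_inv_def)
  qed
  have nil: "[] \<in> reduced_words I G" by (simp add: reduced_words_def)
  have "\<exists>v. set v \<subseteq> alphabet I G \<and>
      (\<forall>w\<in>reduced_words I G. foldr (cons_letter G) v (foldr (cons_letter G) u w) = w)"
    if "set u \<subseteq> alphabet I G" for u
    using that
  proof (induction u)
    case Nil
    then show ?case by (intro exI[of _ "[]"]) simp
  next
    case (Cons a u)
    then obtain v where v: "set v \<subseteq> alphabet I G"
      "\<forall>w\<in>reduced_words I G. foldr (cons_letter G) v (foldr (cons_letter G) u w) = w" by auto
    have "foldr (cons_letter G) u w \<in> reduced_words I G" if "w \<in> reduced_words I G" for w
      using foldr_cons_letter_closed[OF G] Cons.prems that by simp
    moreover have "letter_inv G a \<in> alphabet I G"
      using cancel(1)[OF _ nil] Cons.prems by simp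
    ultimately show ?case
      using v Cons.prems cancel(2) by (intro exI[of _ "v @ [letter_inv G a]"]) auto
  qed
  from this[of u] u obtain v where v: "set v \<subseteq> alphabet I G"
      "\<forall>w\<in>reduced_words I G. foldr (cons_letter G) v (foldr (cons_letter G) u w) = w"
    by (auto simp: reduced_words_def)
  define v' where "v' = foldr (cons_letter G) v []"
  have "v' \<in> reduced_words I G"
    unfolding v'_def using foldr_cons_letter_closed[OF G] v nil by blast
  moreover have "foldr (cons_letter G) v' u = []"
    unfolding v'_def
    using foldr_cons_letter_assoc[OF G v(1) nil u] v(2) nil foldr_cons_letter_Nil[OF u] by auto
  ultimately show "\<exists>y\<in>carrier (free_product I G). y \<otimes>\<^bsub>free_product I G\<^esub> u = \<one>\<^bsub>free_product I G\<^esub>"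
    by (auto simp: free_product_def)
next
  fix x y
  assume "x \<in> carrier (free_product I G)" "y \<in> carrier (free_product I G)"
  then show "x \<otimes>\<^bsub>free_product I G\<^esub> y \<in> carrier (free_product I G)"
    using foldr_cons_letter_closed[OF G]
    by (auto simp: free_product_def reduced_words_def[of I G])
next
  fix x y z
  assume "x \<in> carrier (free_product I G)" "y \<in> carrier (free_product I G)"
    "z \<in> carrier (free_product I G)"
  then show "x \<otimes>\<^bsub>free_product I G\<^esub> y \<otimes>\<^bsub>free_product I G\<^esub> z =
      x \<otimes>\<^bsub>free_product I G\<^esub> (y \<otimes>\<^bsub>free_product I G\<^esub> z)"
    using foldr_cons_letter_assoc[OF G, where u = x and v = y and w = z]
    by (simp add: free_product_def reduced_words_def)
qed (simp_all add: free_product_def reduced_words_def)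

lemma letter_inv_left:
  assumes "\<forall>i\<in>I. group (G i)" and "a \<in> alphabet I G"
  shows "[letter_inv G a] \<otimes>\<^bsub>free_product I G\<^esub> [a] = \<one>\<^bsub>free_product I G\<^esub>"
  using assms by (cases a) (auto simp: alphabet_def letter_inv_def free_product_def group.l_inv)


section \<open>Random walks\<close>

primrec conv_power :: "('g, 'c) monoid_scheme \<Rightarrow> 'g pmf \<Rightarrow> nat \<Rightarrow> 'g pmf" where
  "conv_power H p 0 = return_pmf \<one>\<^bsub>H\<^esub>"
| "conv_power H p (Suc n) = map_pmf (\<lambda>(g, h). g \<otimes>\<^bsub>H\<^esub> h) (pair_pmf (conv_power H p n) p)"

definition iid_seq :: "'w measure \<Rightarrow> 's pmf \<Rightarrow> (nat \<Rightarrow> 'w \<Rightarrow> 's) \<Rightarrow> bool" where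
  "iid_seq M p x \<longleftrightarrow>
     prob_space.indep_vars M (\<lambda>_. count_space UNIV) x UNIV \<and>
     (\<forall>n. distr M (count_space UNIV) (x n) = measure_pmf p)"

primrec walk :: "('g, 'c) monoid_scheme \<Rightarrow> (nat \<Rightarrow> 'w \<Rightarrow> 'g) \<Rightarrow> nat \<Rightarrow> 'w \<Rightarrow> 'g" where
  "walk H x 0 \<omega> = \<one>\<^bsub>H\<^esub>"
| "walk H x (Suc n) \<omega> = walk H x n \<omega> \<otimes>\<^bsub>H\<^esub> x n \<omega>"

text \<open>\<open>x\<close> is the sequence of increments, which are letters.\<close>

definition free_product_walk ::
    "'i set \<Rightarrow> ('i \<Rightarrow> ('a, 'b) monoid_scheme) \<Rightarrow> (nat \<Rightarrow> 'w \<Rightarrow> 'i \<times> 'a)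
      \<Rightarrow> nat \<Rightarrow> 'w \<Rightarrow> ('i \<times> 'a) list" where
  "free_product_walk I G x = walk (free_product I G) (\<lambda>n \<omega>. [x n \<omega>])"

text \<open>A random walk on a group is spatially homogeneous, so transience of the neutral element is
  transience of the walk.\<close>

definition transient_walk ::
    "('g, 'c) monoid_scheme \<Rightarrow> 'w measure \<Rightarrow> (nat \<Rightarrow> 'w \<Rightarrow> 'g) \<Rightarrow> bool" where
  "transient_walk H M X \<longleftrightarrow> (AE \<omega> in M. finite {n. X n \<omega> = \<one>\<^bsub>H\<^esub>})"


section \<open>Infinite words and the harmonic measure\<close>

definition infinite_words ::
    "'i set \<Rightarrow> ('i \<Rightarrow> ('a, 'b) monoid_scheme) \<Rightarrow> (nat \<Rightarrow> 'i \<times> 'a) set" where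
  "infinite_words I G = {\<xi>. \<forall>n. map \<xi> [0..<n] \<in> reduced_words I G}"

definition infinite_word_space ::
    "'i set \<Rightarrow> ('i \<Rightarrow> ('a, 'b) monoid_scheme) \<Rightarrow> (nat \<Rightarrow> 'i \<times> 'a) measure" where
  "infinite_word_space I G =
     restrict_space (\<Pi>\<^sub>M n\<in>(UNIV :: nat set). count_space (alphabet I G)) (infinite_words I G)"

definition cylinder :: "'s list \<Rightarrow> (nat \<Rightarrow> 's) set" where
  "cylinder u = {\<xi>. map \<xi> [0..<length u] = u}"

definition common_prefix_length :: "'s list \<Rightarrow> (nat \<Rightarrow> 's) \<Rightarrow> nat" where
  "common_prefix_length w \<xi> = length (longest_common_prefix w (map \<xi> [0..<length w]))"

text \<open>The limit \<open>Xinf\<close> is only determined almost surely, so the harmonic measure is the law of any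
  version of it.\<close>

definition is_harmonic_measure ::
    "'i set \<Rightarrow> ('i \<Rightarrow> ('a, 'b) monoid_scheme) \<Rightarrow> 'w measure \<Rightarrow> (nat \<Rightarrow> 'w \<Rightarrow> ('i \<times> 'a) list)
      \<Rightarrow> (nat \<Rightarrow> 'i \<times> 'a) measure \<Rightarrow> bool" where
  "is_harmonic_measure I G M X \<nu> \<longleftrightarrow>
     (\<exists>Xinf \<in> M \<rightarrow>\<^sub>M infinite_word_space I G.
        (AE \<omega> in M.
           filterlim (\<lambda>n. common_prefix_length (X n \<omega>) (Xinf \<omega>)) at_top sequentially) \<and>
        \<nu> = distr M (infinite_word_space I G) Xinf)"


section \<open>Traffic Equations and Markovian multiplicative measures\<close>

text \<open>Vectors indexed by the alphabet are extensional functions, so that equality of functions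
  is equality of vectors.\<close>

definition open_simplex :: "'s set \<Rightarrow> ('s \<Rightarrow> real) set" where
  "open_simplex S = {x \<in> extensional S. (\<forall>u\<in>S. x u > 0) \<and> (\<Sum>u\<in>S. x u) = 1}"

definition traffic_equations ::
    "'i set \<Rightarrow> ('i \<Rightarrow> ('a, 'b) monoid_scheme) \<Rightarrow> ('i \<times> 'a) pmf \<Rightarrow> ('i \<times> 'a \<Rightarrow> real) \<Rightarrow> bool" where
  "traffic_equations I G \<mu> x \<longleftrightarrow>
     (\<forall>a\<in>alphabet I G.
        x a = pmf \<mu> a * (\<Sum>u\<in>alphabet I G - letters_like I G a. x u)
            + (\<Sum>(u, v)\<in>{(u, v) \<in> alphabet I G \<times> alphabet I G.
                          [u] \<otimes>\<^bsub>free_product I G\<^esub> [v] = [a]}. pmf \<mu> u * x v)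
            + (\<Sum>u\<in>alphabet I G - letters_like I G a.
                 pmf \<mu> (letter_inv G u)
                 * (x u / (\<Sum>v\<in>alphabet I G - letters_like I G u. x v)) * x a))"

definition markovian_multiplicative ::
    "'i set \<Rightarrow> ('i \<Rightarrow> ('a, 'b) monoid_scheme) \<Rightarrow> ('i \<times> 'a \<Rightarrow> real)
      \<Rightarrow> (nat \<Rightarrow> 'i \<times> 'a) measure \<Rightarrow> bool" where
  "markovian_multiplicative I G r \<nu> \<longleftrightarrow>
     prob_space \<nu> \<and> space \<nu> = infinite_words I G \<and> sets \<nu> = sets (infinite_word_space I G) \<and>
     (\<forall>u\<in>reduced_words I G. u \<noteq> [] \<longrightarrow>
        measure \<nu> (cylinder u \<inter> infinite_words I G) =
          (\<Prod>a\<leftarrow>butlast u. r a / (\<Sum>b\<in>alphabet I G - letters_like I G a. r b)) * r (last u))"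

end

theory Submission
  imports Defs
begin

text \<open>
  The limit \<open>X\<^sub>\<infinity>\<close> exists because a transient walk leaves every finite set of words, while one step
  changes only the last letter of the current word. The walk can end up in the cone below
  \<open>a v\<close> only by passing through \<open>a\<close>, so by the Markov property at the first visit of \<open>a\<close> the
  probability that \<open>X\<^sub>\<infinity>\<close> starts with \<open>a v\<close> is \<open>q(a)\<close> times the probability that it starts with
  \<open>v\<close>, where \<open>q(a)\<close> is the probability of ever visiting \<open>a\<close>. With \<open>r(a)\<close> the probability that
  \<open>X\<^sub>\<infinity>\<close> starts with \<open>a\<close>, this gives \<open>q(a) = r(a) / r(\<Sigma> - \<Sigma>\<^sub>a)\<close> and hence the multiplicative
  form of the law of \<open>X\<^sub>\<infinity>\<close>; conditioning on the first step yields the Traffic Equations.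

  For uniqueness, let \<open>x\<close> be any solution. Divided by \<open>x(\<Sigma> - \<Sigma>\<^sub>a)\<close>, the equations say that the
  ratios \<open>x(a) / x(\<Sigma> - \<Sigma>\<^sub>a)\<close> satisfy the first-step equations of the hitting probabilities, whose
  least solution is \<open>q\<close>. So the ratios of \<open>x\<close> dominate those of \<open>r\<close>, and since both vectors have total
  mass 1, a monotonicity argument forces \<open>x = r\<close>.
\<close>

section \<open>Reduced words\<close>

locale free_product_family =
  fixes I :: "'i set" and G :: "'i \<Rightarrow> ('a, 'b) monoid_scheme"
  assumes finite_I: "finite I" and card_I: "card I \<ge> 2"
    and group_G: "\<And>i. i \<in> I \<Longrightarrow> group (G i)"
    and finite_G: "\<And>i. i \<in> I \<Longrightarrow> finite (carrier (G i))"
    and card_G: "\<And>i. i \<in> I \<Longrightarrow> card (carrier (G i)) > 1"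
begin

abbreviation \<Sigma> :: "('i \<times> 'a) set" where "\<Sigma> \<equiv> alphabet I G"
abbreviation L :: "('i \<times> 'a) list set" where "L \<equiv> reduced_words I G"
abbreviation outside :: "'i \<times> 'a \<Rightarrow> ('i \<times> 'a) set" where
  "outside a \<equiv> \<Sigma> - letters_like I G a"
abbreviation mul :: "('i \<times> 'a) list \<Rightarrow> ('i \<times> 'a) list \<Rightarrow> ('i \<times> 'a) list" (infixl "\<odot>" 70) where
  "u \<odot> v \<equiv> foldr (cons_letter G) u v"
abbreviation inv_letter :: "'i \<times> 'a \<Rightarrow> 'i \<times> 'a" where "inv_letter \<equiv> letter_inv G"
text \<open>For letters of equal index this is the inverse of \<open>u\<close> times
  \<open>a\<close>, that is the solution \<open>v\<close> of \<open>u * v = a\<close>. It is a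
  letter only for \<open>u \<noteq> a\<close>.\<close>

abbreviation quot :: "'i \<times> 'a \<Rightarrow> 'i \<times> 'a \<Rightarrow> 'i \<times> 'a" where
  "quot u a \<equiv> (fst a, inv\<^bsub>G (fst a)\<^esub> (snd u) \<otimes>\<^bsub>G (fst a)\<^esub> snd a)"

lemma all_group: "\<forall>i\<in>I. group (G i)"
  using group_G by blast

sublocale H: group "free_product I G"
  by (rule group_free_product[OF all_group])

lemma carrier_H [simp]: "carrier (free_product I G) = L"
  and mult_H [simp]: "x \<otimes>\<^bsub>free_product I G\<^esub> y = x \<odot> y"
  and one_H [simp]: "\<one>\<^bsub>free_product I G\<^esub> = []"
  by (auto simp: free_product_def)

lemma mem_alphabet: "a \<in> \<Sigma> \<longleftrightarrow> fst a \<in> I \<and> snd a \<in> carrier (G (fst a)) \<and> snd a \<noteq> \<one>\<^bsub>G (fst a)\<^esub>"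
  by (cases a) (auto simp: alphabet_def)

lemma mem_outside: "u \<in> outside a \<longleftrightarrow> u \<in> \<Sigma> \<and> fst u \<noteq> fst a"
  by (auto simp: letters_like_def)

lemma outside_cong: "fst a = fst b \<Longrightarrow> outside a = outside b"
  by (auto simp: letters_like_def)

lemma finite_alphabet [simp, intro]: "finite \<Sigma>"
  unfolding alphabet_def using finite_I finite_G by (intro finite_SigmaI) auto

lemma exists_letter: assumes "i \<in> I" shows "\<exists>a\<in>\<Sigma>. fst a = i"
proof -
  interpret group "G i" by (rule group_G[OF assms])
  have "carrier (G i) \<noteq> {\<one>\<^bsub>G i\<^esub>}"
  proof
    assume "carrier (G i) = {\<one>\<^bsub>G i\<^esub>}"
    then have "card (carrier (G i)) = 1" by simp
    then show False using card_G[OF assms] by simp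
  qed
  then obtain g where "g \<in> carrier (G i)" "g \<noteq> \<one>\<^bsub>G i\<^esub>" using one_closed by blast
  then show ?thesis using assms by (intro bexI[of _ "(i, g)"]) (auto simp: mem_alphabet)
qed

text \<open>There are at least two factors, and each contributes a letter. This is what makes the
  denominators of the Traffic Equations sums over nonempty sets.\<close>

lemma exists_outside: "outside a \<noteq> {}"
proof -
  have "\<exists>i\<in>I. i \<noteq> fst a"
  proof (rule ccontr)
    assume "\<not> ?thesis"
    then have "card I \<le> card {fst a}" by (intro card_mono) auto
    then show False using card_I by simp
  qed
  then show ?thesis using exists_letter by (metis empty_iff mem_outside)
qed

lemma reduced_Nil [simp]: "[] \<in> L"
  by (simp add: reduced_words_def)

lemma reduced_Cons: "a # w \<in> L \<longleftrightarrow> a \<in> \<Sigma> \<and> w \<in> L \<and> (w \<noteq> [] \<longrightarrow> fst (hd w) \<noteq> fst a)"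
  by (cases w) (auto simp: reduced_words_def)

lemma reduced_append: "u @ w \<in> L \<Longrightarrow> u \<in> L \<and> w \<in> L"
  by (auto simp: reduced_words_def distinct_adj_append_iff)

lemma reduced_prefix: "prefix u w \<Longrightarrow> w \<in> L \<Longrightarrow> u \<in> L"
  by (metis prefix_def reduced_append)

lemma inv_letter_closed [simp, intro]: "a \<in> \<Sigma> \<Longrightarrow> inv_letter a \<in> \<Sigma>"
proof -
  assume a: "a \<in> \<Sigma>"
  interpret group "G (fst a)" using a group_G by (auto simp: mem_alphabet)
  show "inv_letter a \<in> \<Sigma>"
    using a by (auto simp: mem_alphabet letter_inv_def inv_eq_1_iff)
qed

lemma fst_inv_letter [simp]: "fst (inv_letter a) = fst a"
  by (simp add: letter_inv_def)

lemma inv_letter_inv_letter [simp]: "a \<in> \<Sigma> \<Longrightarrow> inv_letter (inv_letter a) = a"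
proof -
  assume a: "a \<in> \<Sigma>"
  interpret group "G (fst a)" using a group_G by (auto simp: mem_alphabet)
  show "inv_letter (inv_letter a) = a"
    using a by (auto simp: mem_alphabet letter_inv_def)
qed

lemma quot_closed:
  assumes "a \<in> \<Sigma>" "u \<in> \<Sigma>" "fst u = fst a" "u \<noteq> a"
  shows "quot u a \<in> \<Sigma>"
proof -
  interpret group "G (fst a)" using assms group_G by (auto simp: mem_alphabet)
  show ?thesis using assms
    by (auto simp: mem_alphabet) (metis inv_closed inv_equality inv_inv prod.expand)
qed

lemma letter_mult_eq_iff:
  assumes "a \<in> \<Sigma>" "u \<in> \<Sigma>" "b \<in> \<Sigma>" "fst u = fst a" "fst b = fst a"
  shows "snd u \<otimes>\<^bsub>G (fst a)\<^esub> snd b = snd a \<longleftrightarrow> b = quot u a"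
proof -
  interpret group "G (fst a)" using assms group_G by (auto simp: mem_alphabet)
  have "snd u \<otimes>\<^bsub>G (fst a)\<^esub> snd b = snd a \<longleftrightarrow> snd b = inv\<^bsub>G (fst a)\<^esub> (snd u) \<otimes>\<^bsub>G (fst a)\<^esub> snd a"
    using assms by (metis inv_solve_left' mem_alphabet)
  then show ?thesis using assms by (auto simp: prod_eq_iff)
qed

lemma letter_mult_neq:
  assumes "a \<in> \<Sigma>" "b \<in> \<Sigma>" "fst b = fst a"
  shows "snd a \<otimes>\<^bsub>G (fst a)\<^esub> snd b \<noteq> snd a"
proof -
  interpret group "G (fst a)" using assms group_G by (auto simp: mem_alphabet)
  show ?thesis using assms by (simp add: mem_alphabet)
qed

lemma letter_mult_one_iff:
  assumes "u \<in> \<Sigma>" "b \<in> \<Sigma>" "fst u = fst b"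
  shows "snd u \<otimes>\<^bsub>G (fst u)\<^esub> snd b = \<one>\<^bsub>G (fst u)\<^esub> \<longleftrightarrow> b = inv_letter u"
proof -
  interpret group "G (fst u)" using assms group_G by (auto simp: mem_alphabet)
  show ?thesis using assms
    by (auto simp: letter_inv_def mem_alphabet prod_eq_iff)
      (metis inv_equality inv_inv inv_closed r_inv)+
qed

section \<open>Multiplication of reduced words by a single letter\<close>

lemma single_mult_Cons:
  "[a] \<odot> (b # w) =
    (if fst a = fst b
     then if snd a \<otimes>\<^bsub>G (fst a)\<^esub> snd b = \<one>\<^bsub>G (fst a)\<^esub> then w
          else (fst a, snd a \<otimes>\<^bsub>G (fst a)\<^esub> snd b) # w
     else a # b # w)"
  by (cases a; cases b) auto

lemma cons_letter_Nil [simp]: "cons_letter G a [] = [a]"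
  by (cases a) simp

lemma mul_closed [simp, intro]: "u \<in> L \<Longrightarrow> v \<in> L \<Longrightarrow> u \<odot> v \<in> L"
  using H.m_closed by simp

lemma mul_assoc: "u \<in> L \<Longrightarrow> v \<in> L \<Longrightarrow> w \<in> L \<Longrightarrow> (u \<odot> v) \<odot> w = u \<odot> (v \<odot> w)"
  using H.m_assoc by simp

lemma mul_Nil [simp]: "u \<in> L \<Longrightarrow> u \<odot> [] = u"
  using H.r_one by simp

lemma single_closed [simp, intro]: "a \<in> \<Sigma> \<Longrightarrow> [a] \<in> L"
  by (simp add: reduced_Cons)

lemma inv_letter_mult:
  assumes "u \<in> \<Sigma>" shows "[inv_letter u] \<odot> [u] = []" "[u] \<odot> [inv_letter u] = []"
  using letter_inv_left[OF all_group assms] letter_inv_left[OF all_group inv_letter_closed[OF assms]] assms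
  by simp_all

lemma single_mult_eq_iff:
  assumes "u \<in> \<Sigma>" "w \<in> L" "g \<in> L"
  shows "[u] \<odot> w = g \<longleftrightarrow> w = [inv_letter u] \<odot> g"
proof -
  have "[u] \<odot> ([inv_letter u] \<odot> g) = [u] \<odot> [inv_letter u] \<odot> g"
    by (rule mul_assoc[symmetric]) (use assms in auto)
  then have "[u] \<odot> ([inv_letter u] \<odot> g) = g"
    by (simp only: inv_letter_mult[OF assms(1)]) simp
  moreover have "[inv_letter u] \<odot> ([u] \<odot> w) = [inv_letter u] \<odot> [u] \<odot> w"
    by (rule mul_assoc[symmetric]) (use assms in auto)
  then have "[inv_letter u] \<odot> ([u] \<odot> w) = w"
    by (simp only: inv_letter_mult[OF assms(1)]) simp
  ultimately show ?thesis by metis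
qed

lemma append_eq_mult: "u @ w \<in> L \<Longrightarrow> u \<odot> w = u @ w"
proof (induction u)
  case (Cons a u)
  then have "u \<odot> w = u @ w" "a # (u @ w) \<in> L" by (auto simp: reduced_Cons)
  then show ?case
    using single_mult_Cons[of a "hd (u @ w)" "tl (u @ w)"] cons_letter_Nil[of a]
    by (cases "u @ w") (auto simp: reduced_Cons)
qed simp

text \<open>Only the last letter \<open>b\<close> of \<open>w\<close> meets \<open>s\<close>, and
  \<open>b * s\<close> is either neutral, or a letter with the index of \<open>b\<close>, or the
  reduced word \<open>[b, s]\<close>. In each case the rest of \<open>w\<close> is put in front
  without further cancellation. All path properties of the walk rest on this.\<close>

lemma mult_single_cases:
  assumes w: "w \<in> L" and s: "s \<in> \<Sigma>"
  obtains "w \<odot> [s] = w @ [s]" | "w \<noteq> []" "w \<odot> [s] = butlast w"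
    | s' where "w \<noteq> []" "w \<odot> [s] = butlast w @ [s']"
proof (cases w rule: rev_cases)
  case Nil
  then show ?thesis using that by simp
next
  case (snoc v b)
  then have v: "v \<in> L" "b \<in> \<Sigma>" using w reduced_append[of v "[b]"] reduced_Cons[of b "[]"] by blast+
  have "w \<odot> [s] = v \<odot> ([b] \<odot> [s])" using snoc by simp
  consider "[b] \<odot> [s] = []" | s' where "[b] \<odot> [s] = [s']" "fst s' = fst b" | "[b] \<odot> [s] = [b, s]" "fst s \<noteq> fst b"
    using single_mult_Cons[of b s "[]"] by (auto split: if_splits)
  then show ?thesis
  proof cases
    case 1
    then show ?thesis using that(2) snoc v by (simp add: \<open>w \<odot> [s] = v \<odot> ([b] \<odot> [s])\<close>)
  next
    case (2 s')
    have "[s'] \<in> L" using mul_closed[of "[b]" "[s]"] 2 v s by simp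
    then have "v @ [s'] \<in> L" using w snoc 2
      by (auto simp: reduced_words_def distinct_adj_append_iff)
    then show ?thesis using append_eq_mult[of v "[s']"] 2 that(3) snoc \<open>w \<odot> [s] = v \<odot> ([b] \<odot> [s])\<close> by auto
  next
    case 3
    then have "v @ [b, s] \<in> L" using w snoc s
      by (auto simp: reduced_words_def distinct_adj_append_iff)
    then show ?thesis using append_eq_mult[of v "[b,s]"] 3 that(1) snoc \<open>w \<odot> [s] = v \<odot> ([b] \<odot> [s])\<close> by auto
  qed
qed

lemma prefix_single_iff: "prefix [a] w \<longleftrightarrow> w \<noteq> [] \<and> hd w = a"
  by (cases w) auto

text \<open>If \<open>w\<close> starts with the index of \<open>a\<close>, both sides fail: the
  product starts with a letter other than \<open>a\<close>, or \<open>a\<close> is cancelled and the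
  next letter has another index. Otherwise the product is plainly \<open>a # w\<close>.\<close>

lemma prefix_single_mult_same:
  assumes "a \<in> \<Sigma>" "w \<in> L" "v \<noteq> []" "fst (hd v) \<noteq> fst a"
  shows "prefix (a # v) ([a] \<odot> w) \<longleftrightarrow> prefix v w"
proof (cases w)
  case Nil
  then show ?thesis using assms by (auto simp: prefix_Nil)
next
  case (Cons b w')
  then have b: "b \<in> \<Sigma>" "w' \<noteq> [] \<Longrightarrow> fst (hd w') \<noteq> fst b" using assms(2) by (auto simp: reduced_Cons)
  obtain c v' where v: "v = c # v'" using assms(3) by (cases v) auto
  show ?thesis
  proof (cases "fst a = fst b")
    case False
    then show ?thesis using Cons by (cases a; cases b) auto
  next
    case True
    then have "snd a \<otimes>\<^bsub>G (fst a)\<^esub> snd b \<noteq> snd a" using letter_mult_neq[OF assms(1) b(1)] by simp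
    then have "(fst a, snd a \<otimes>\<^bsub>G (fst a)\<^esub> snd b) \<noteq> a" by (metis snd_conv)
    moreover have "\<not> prefix (a # v) w'" using b(2) True by (cases w') auto
    ultimately have "\<not> prefix (a # v) ([a] \<odot> w)"
      unfolding Cons single_mult_Cons using True by auto
    moreover have "\<not> prefix v w" using Cons True v assms(4) by auto
    ultimately show ?thesis by blast
  qed
qed

text \<open>This lemma and the next two decide when a walk whose first increment is \<open>u\<close>
  stands on a word starting with \<open>a\<close>. The cases \<open>u = a\<close>, \<open>u\<close>
  of the same index, and \<open>u\<close> of another index correspond to the three terms of the
  Traffic Equations.\<close>

lemma prefix_single_mult_self:
  assumes "a \<in> \<Sigma>" "w \<in> L"
  shows "prefix [a] ([a] \<odot> w) \<longleftrightarrow> w = [] \<or> fst (hd w) \<noteq> fst a"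
proof (cases w)
  case (Cons b w')
  then have b: "b \<in> \<Sigma>" "w' \<noteq> [] \<Longrightarrow> fst (hd w') \<noteq> fst b" using assms(2) by (auto simp: reduced_Cons)
  show ?thesis
  proof (cases "fst a = fst b")
    case False
    then show ?thesis using Cons by (cases a; cases b) auto
  next
    case True
    then have "snd a \<otimes>\<^bsub>G (fst a)\<^esub> snd b \<noteq> snd a" using letter_mult_neq[OF assms(1) b(1)] by simp
    then show ?thesis using Cons True b(2) single_mult_Cons[of a b w']
      by (cases w') (auto simp: prod_eq_iff)
  qed
qed simp

lemma prefix_single_mult_like:
  assumes "a \<in> \<Sigma>" "u \<in> \<Sigma>" "fst u = fst a" "u \<noteq> a" "w \<in> L"
  shows "prefix [a] ([u] \<odot> w) \<longleftrightarrow> prefix [quot u a] w"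
proof (cases w)
  case Nil
  then show ?thesis using assms by auto
next
  case (Cons b w')
  then have b: "b \<in> \<Sigma>" "w' \<noteq> [] \<Longrightarrow> fst (hd w') \<noteq> fst b" using assms by (auto simp: reduced_Cons)
  show ?thesis
  proof (cases "fst a = fst b")
    case False
    then show ?thesis using Cons assms by (cases u; cases b) auto
  next
    case True
    let ?p = "snd u \<otimes>\<^bsub>G (fst a)\<^esub> snd b"
    have 1: "?p = snd a \<longleftrightarrow> b = quot u a"
      using letter_mult_eq_iff[OF assms(1,2) b(1) assms(3)] True by simp
    have 2: "snd a \<noteq> \<one>\<^bsub>G (fst a)\<^esub>" using assms by (simp add: mem_alphabet)
    have 3: "[u] \<odot> w = (if ?p = \<one>\<^bsub>G (fst a)\<^esub> then w' else (fst a, ?p) # w')"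
      using single_mult_Cons[of u b w'] Cons True assms(3) by simp
    have 4: "\<not> prefix [a] w'" using b(2) True by (auto simp: prefix_single_iff)
    have "prefix [a] ([u] \<odot> w) \<longleftrightarrow> ?p = snd a"
    proof (cases "?p = \<one>\<^bsub>G (fst a)\<^esub>")
      case True
      then show ?thesis using 2 4 unfolding 3 by auto
    next
      case False
      then show ?thesis unfolding 3 by (auto simp: prefix_single_iff prod_eq_iff)
    qed
    then show ?thesis unfolding 1 by (auto simp add: Cons prefix_single_iff)
  qed
qed

text \<open>A letter \<open>u\<close> of another index blocks the first position unless it is
  cancelled completely, and then \<open>a\<close> must come directly after the cancelling
  letter.\<close>

lemma prefix_single_mult_outside:
  assumes "a \<in> \<Sigma>" "u \<in> outside a" "w \<in> L"
  shows "prefix [a] ([u] \<odot> w) \<longleftrightarrow> prefix [inv_letter u, a] w"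
proof (cases w)
  case Nil
  then show ?thesis using assms(2) unfolding mem_outside by auto
next
  case (Cons b w')
  then have b: "b \<in> \<Sigma>" using assms by (auto simp: reduced_Cons)
  have u: "u \<in> \<Sigma>" "fst u \<noteq> fst a" using assms(2) unfolding mem_outside by auto
  show ?thesis
  proof (cases "fst u = fst b")
    case False
    then have "[u] \<odot> w = u # w" unfolding Cons single_mult_Cons by simp
    moreover have "inv_letter u \<noteq> b" using False fst_inv_letter by metis
    ultimately show ?thesis using u Cons by auto
  next
    case True
    let ?p = "snd u \<otimes>\<^bsub>G (fst u)\<^esub> snd b"
    have 1: "?p = \<one>\<^bsub>G (fst u)\<^esub> \<longleftrightarrow> b = inv_letter u"
      using letter_mult_one_iff[OF u(1) b True] .
    have 3: "[u] \<odot> w = (if ?p = \<one>\<^bsub>G (fst u)\<^esub> then w' else (fst u, ?p) # w')"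
      using single_mult_Cons[of u b w'] Cons True by simp
    have "(fst u, ?p) \<noteq> a" using u(2) by auto
    then have "prefix [a] ([u] \<odot> w) \<longleftrightarrow> ?p = \<one>\<^bsub>G (fst u)\<^esub> \<and> prefix [a] w'"
      unfolding 3 by (simp add: prefix_single_iff)
    also have "\<dots> \<longleftrightarrow> prefix [inv_letter u, a] w" unfolding 1 Cons by auto
    finally show ?thesis .
  qed
qed

end


section \<open>Trajectories of the walk and their limits\<close>

context free_product_family
begin

text \<open>The walk driven by the coordinate process. A walk on any probability space is this
  function applied to its sequence of increments, so it can be studied on sequence space.\<close>

definition pos :: "nat \<Rightarrow> (nat \<Rightarrow> 'i \<times> 'a) \<Rightarrow> ('i \<times> 'a) list" where
  "pos n \<omega> = free_product_walk I G (\<lambda>k \<omega>. \<omega> k) n \<omega>"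

lemma free_product_walk_eq_pos: "free_product_walk I G x n \<omega> = pos n (\<lambda>k. x k \<omega>)"
  unfolding pos_def free_product_walk_def by (induction n) auto

lemma pos_0 [simp]: "pos 0 \<omega> = []"
  and pos_Suc: "pos (Suc n) \<omega> = pos n \<omega> \<odot> [\<omega> n]"
  by (simp_all add: pos_def free_product_walk_def)

abbreviation letter_seqs :: "(nat \<Rightarrow> 'i \<times> 'a) set" where
  "letter_seqs \<equiv> UNIV \<rightarrow> \<Sigma>"

lemma pos_closed [simp, intro]: "\<omega> \<in> letter_seqs \<Longrightarrow> pos n \<omega> \<in> L"
  by (induction n) (auto simp: pos_Suc simp del: foldr.simps foldr_Cons foldr_Nil)

lemma pos_cong: "(\<And>k. k < n \<Longrightarrow> \<omega> k = \<omega>' k) \<Longrightarrow> pos n \<omega> = pos n \<omega>'"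
  by (induction n) (simp_all add: pos_Suc)

text \<open>The Markov property at the level of trajectories: \<open>comb_seq n\<close> follows the
  first sequence for \<open>n\<close> steps and then the second one, so the future is a fresh walk
  translated on the left by the present position.\<close>

lemma pos_comb_seq:
  assumes "\<omega> \<in> letter_seqs" "\<omega>' \<in> letter_seqs"
  shows "pos (n + m) (comb_seq n \<omega> \<omega>') = pos n \<omega> \<odot> pos m \<omega>'"
proof (induction m)
  case 0
  have "pos n (comb_seq n \<omega> \<omega>') = pos n \<omega>" by (rule pos_cong) (simp add: comb_seq_def)
  then show ?case using assms by simp
next
  case (Suc m)
  have "comb_seq n \<omega> \<omega>' (n + m) = \<omega>' m" by (simp add: comb_seq_def)
  then have "pos (n + Suc m) (comb_seq n \<omega> \<omega>') = pos n \<omega> \<odot> pos m \<omega>' \<odot> [\<omega>' m]"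
    using Suc by (simp only: pos_Suc add_Suc_right)
  also have "\<dots> = pos n \<omega> \<odot> (pos m \<omega>' \<odot> [\<omega>' m])"
    by (rule mul_assoc) (use assms in auto)
  finally show ?case by (simp only: pos_Suc)
qed

lemma pos_case_nat:
  assumes "u \<in> \<Sigma>" "\<omega> \<in> letter_seqs"
  shows "pos (Suc m) (case_nat u \<omega>) = [u] \<odot> pos m \<omega>"
proof -
  have "comb_seq 1 (\<lambda>_. u) \<omega> = case_nat u \<omega>"
    by (auto simp: comb_seq_def fun_eq_iff split: nat.split)
  moreover have "pos 1 (\<lambda>_. u) = [u]"
    using pos_Suc[of 0 "\<lambda>_. u"] by simp
  ultimately show ?thesis
    using pos_comb_seq[of "\<lambda>_. u" \<omega> 1 m] assms by simp
qed

text \<open>The increments are letters, so the walk enters the cone of words longer than \<open>[a]\<close> that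
  start with \<open>a\<close> only through \<open>[a]\<close>.\<close>

lemma cone_entered_through_apex:
  assumes \<omega>: "\<omega> \<in> letter_seqs" and "2 \<le> length (pos n \<omega>)" "hd (pos n \<omega>) = a"
  shows "\<exists>m<n. pos m \<omega> = [a]"
  using assms(2,3)
proof (induction n)
  case (Suc n)
  let ?w = "pos n \<omega>"
  have "?w \<in> L" "\<omega> n \<in> \<Sigma>" using \<omega> by auto
  then show ?case
  proof (cases rule: mult_single_cases)
    case 1
    then have "2 \<le> length (?w @ [\<omega> n])" "hd (?w @ [\<omega> n]) = a" using Suc.prems by (simp_all only: pos_Suc)
    \<comment> \<open>Appending a letter is the only move that can enter the cone, and then only
      from \<open>[a]\<close>. In the other two cases the last letter is removed or replaced and at
      least two letters remain, so the head was already \<open>a\<close> and the word was already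
      long.\<close>
    then have "?w = [a] \<or> 2 \<le> length ?w \<and> hd ?w = a"
      by (cases ?w rule: list.exhaust; cases "tl ?w") auto
    then show ?thesis using Suc.IH less_Suc_eq by blast
  next
    case 2
    then have "2 \<le> length (butlast ?w)" "hd (butlast ?w) = a" using Suc.prems by (simp_all only: pos_Suc)
    then have "2 \<le> length ?w \<and> hd ?w = a"
      by (cases ?w rule: rev_cases) (auto simp: hd_append)
    then show ?thesis using Suc.IH less_Suc_eq by blast
  next
    case (3 s')
    then have "2 \<le> length (butlast ?w @ [s'])" "hd (butlast ?w @ [s']) = a" using Suc.prems by (simp_all only: pos_Suc)
    then have "2 \<le> length ?w \<and> hd ?w = a"
      by (cases ?w rule: rev_cases) (auto simp: hd_append split: if_splits)
    then show ?thesis using Suc.IH less_Suc_eq by blast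
  qed
qed simp

text \<open>A step touches the last letter only. The inequalities are strict in order to keep that
  letter outside the compared part.\<close>

lemma take_pos_Suc:
  assumes "\<omega> \<in> letter_seqs" "k < length (pos n \<omega>)" "k < length (pos (Suc n) \<omega>)"
  shows "take k (pos (Suc n) \<omega>) = take k (pos n \<omega>)"
proof -
  have "pos n \<omega> \<in> L" "\<omega> n \<in> \<Sigma>" using assms(1) by auto
  then show ?thesis
    using assms(2,3) unfolding pos_Suc
    by (cases rule: mult_single_cases) (auto simp: take_butlast simp del: foldr_Cons)
qed

text \<open>For a converging trajectory this says that the limit starts with \<open>u\<close>. It
  does not mention the limit, and it is a countable combination of events about single positions,
  hence measurable.\<close>

definition eventually_prefix :: "('i \<times> 'a) list \<Rightarrow> (nat \<Rightarrow> 'i \<times> 'a) \<Rightarrow> bool" where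
  "eventually_prefix u \<omega> \<longleftrightarrow> (\<forall>\<^sub>F n in sequentially. prefix u (pos n \<omega>))"

lemma eventually_prefix_comparable:
  assumes "eventually_prefix u \<omega>" "eventually_prefix v \<omega>" "length u \<le> length v"
  shows "prefix u v"
proof -
  have "\<forall>\<^sub>F n in sequentially. prefix u (pos n \<omega>) \<and> prefix v (pos n \<omega>)"
    using assms(1,2) unfolding eventually_prefix_def by (rule eventually_conj)
  then obtain n where "prefix u (pos n \<omega>)" "prefix v (pos n \<omega>)"
    unfolding eventually_sequentially by blast
  then show ?thesis using assms(3) prefix_length_prefix by blast
qed

lemma eventually_prefix_mono: "prefix u v \<Longrightarrow> eventually_prefix v \<omega> \<Longrightarrow> eventually_prefix u \<omega>"
  unfolding eventually_prefix_def by (erule eventually_mono) (rule prefix_order.trans)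

lemma eventually_prefix_unique:
  assumes "eventually_prefix u \<omega>" "eventually_prefix v \<omega>" "length u = length v"
  shows "u = v"
  using eventually_prefix_comparable[OF assms(1,2)] assms(3)
  by (metis le_refl not_equal_is_parallel parallelE)

lemma eventually_prefix_reduced:
  assumes "\<omega> \<in> letter_seqs" "eventually_prefix u \<omega>"
  shows "u \<in> L"
  using assms reduced_prefix unfolding eventually_prefix_def eventually_sequentially by blast

lemma eventually_prefix_shift:
  "eventually_prefix u \<omega> \<longleftrightarrow> (\<forall>\<^sub>F n in sequentially. prefix u (pos (k + n) \<omega>))"
  unfolding eventually_prefix_def
  using eventually_sequentially_seg[of "\<lambda>n. prefix u (pos n \<omega>)" k] by (simp add: add.commute)

definition escaping :: "(nat \<Rightarrow> 'i \<times> 'a) \<Rightarrow> bool" where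
  "escaping \<omega> \<longleftrightarrow> (\<forall>g\<in>L. finite {n. pos n \<omega> = g})"

text \<open>The alphabet is finite, so there are finitely many words of length at most
  \<open>k\<close>, each visited finitely often.\<close>

lemma escaping_length:
  assumes "\<omega> \<in> letter_seqs" "escaping \<omega>"
  shows "\<forall>\<^sub>F n in sequentially. k < length (pos n \<omega>)"
proof -
  have "finite {w. set w \<subseteq> \<Sigma> \<and> length w \<le> k}"
    by (rule finite_lists_length_le) simp
  then have fin: "finite {w \<in> L. length w \<le> k}"
    by (rule rev_finite_subset) (auto simp: reduced_words_def)
  have "finite (\<Union>g\<in>{w \<in> L. length w \<le> k}. {n. pos n \<omega> = g})"
    using fin assms(2) by (auto simp: escaping_def)
  moreover have "{n. \<not> k < length (pos n \<omega>)} \<subseteq> (\<Union>g\<in>{w \<in> L. length w \<le> k}. {n. pos n \<omega> = g})"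
    using assms(1) by auto
  ultimately show ?thesis
    unfolding cofinite_eq_sequentially[symmetric] eventually_cofinite by (rule rev_finite_subset)
qed

text \<open>From the time on after which all positions are longer than \<open>k\<close>,
  \<open>take_pos_Suc\<close> freezes their first \<open>k\<close> letters.\<close>

lemma escaping_eventually_prefix:
  assumes "\<omega> \<in> letter_seqs" "escaping \<omega>"
  shows "\<exists>u. length u = k \<and> eventually_prefix u \<omega>"
proof -
  obtain N where N: "\<And>n. n \<ge> N \<Longrightarrow> k < length (pos n \<omega>)"
    using escaping_length[OF assms, of k] unfolding eventually_sequentially by blast
  have "take k (pos n \<omega>) = take k (pos N \<omega>)" if "n \<ge> N" for n
    using that
  proof (induction n rule: dec_induct)
    case (step n)
    then show ?case using take_pos_Suc[OF assms(1)] N[of n] N[of "Suc n"] by simp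
  qed simp
  then have "eventually_prefix (take k (pos N \<omega>)) \<omega>"
    unfolding eventually_prefix_def eventually_sequentially by (metis take_is_prefix)
  then show ?thesis using N[of N] by (intro exI[of _ "take k (pos N \<omega>)"]) simp
qed

definition converges_to :: "(nat \<Rightarrow> 'i \<times> 'a) \<Rightarrow> (nat \<Rightarrow> 'i \<times> 'a) \<Rightarrow> bool" where
  "converges_to \<omega> \<xi> \<longleftrightarrow> (\<forall>k. eventually_prefix (map \<xi> [0..<k]) \<omega>)"

lemma converges_to_unique:
  assumes "converges_to \<omega> \<xi>" "converges_to \<omega> \<xi>'"
  shows "\<xi> = \<xi>'"
proof
  fix k
  have "map \<xi> [0..<Suc k] = map \<xi>' [0..<Suc k]"
    by (rule eventually_prefix_unique[of _ \<omega>]) (use assms in \<open>auto simp: converges_to_def simp del: upt_Suc\<close>)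
  then show "\<xi> k = \<xi>' k" by simp
qed

lemma converges_to_infinite_words:
  "\<omega> \<in> letter_seqs \<Longrightarrow> converges_to \<omega> \<xi> \<Longrightarrow> \<xi> \<in> infinite_words I G"
  using eventually_prefix_reduced by (auto simp: converges_to_def infinite_words_def)

lemma converges_to_prefix_iff:
  assumes "converges_to \<omega> \<xi>"
  shows "eventually_prefix u \<omega> \<longleftrightarrow> \<xi> \<in> cylinder u"
proof -
  have *: "eventually_prefix (map \<xi> [0..<length u]) \<omega>"
    using assms by (simp add: converges_to_def)
  show ?thesis
    using * eventually_prefix_unique[OF _ *, of u] by (auto simp: cylinder_def)
qed

lemma converges_to_iff_eventually_prefix:
  "(\<exists>\<xi>. converges_to \<omega> \<xi>) \<longleftrightarrow> (\<forall>k. \<exists>u. length u = k \<and> eventually_prefix u \<omega>)"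
proof
  assume "\<exists>\<xi>. converges_to \<omega> \<xi>"
  then obtain \<xi> where "converges_to \<omega> \<xi>" by blast
  then show "\<forall>k. \<exists>u. length u = k \<and> eventually_prefix u \<omega>"
    unfolding converges_to_def by (metis diff_zero length_map length_upt)
next
  assume "\<forall>k. \<exists>u. length u = k \<and> eventually_prefix u \<omega>"
  then obtain f where f: "\<And>k. length (f k) = k" "\<And>k. eventually_prefix (f k) \<omega>"
    by metis
  \<comment> \<open>The chosen prefixes are nested, so letter \<open>j\<close> is the same in all of
    them that are longer than \<open>j\<close>. Reading the diagonal therefore gives the limit
    word.\<close>
  have nth: "f (Suc j) ! j = f k ! j" if "j < k" for j k
  proof -
    have "prefix (f (Suc j)) (f k)"
      using eventually_prefix_comparable[OF f(2) f(2)] f(1) that by simp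
    then show ?thesis using f(1) by (auto simp: prefix_def nth_append)
  qed
  have "map (\<lambda>j. f (Suc j) ! j) [0..<k] = f k" for k
    using f(1) nth by (auto intro!: nth_equalityI)
  then show "\<exists>\<xi>. converges_to \<omega> \<xi>"
    using f(2) by (intro exI[of _ "\<lambda>j. f (Suc j) ! j"]) (simp add: converges_to_def)
qed

text \<open>\<open>common_prefix_length\<close> cuts the infinite word at the length of
  \<open>w\<close>. This loses nothing, as a common prefix is never longer than
  \<open>w\<close>.\<close>

lemma le_common_prefix_length_iff:
  "k \<le> common_prefix_length w \<xi> \<longleftrightarrow> prefix (map \<xi> [0..<k]) w"
proof
  let ?l = "longest_common_prefix w (map \<xi> [0..<length w])"
  assume "k \<le> common_prefix_length w \<xi>"
  then have k: "k \<le> length ?l" by (simp add: common_prefix_length_def)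
  have "prefix ?l (map \<xi> [0..<length w])" "prefix ?l w"
    by (rule longest_common_prefix_prefix2 longest_common_prefix_prefix1)+
  then have "k \<le> length w" using k prefix_length_le[of ?l w] by linarith
  obtain zs where "map \<xi> [0..<length w] = ?l @ zs"
    using \<open>prefix ?l (map \<xi> [0..<length w])\<close> by (auto simp: prefix_def)
  then have "take k (map \<xi> [0..<length w]) = take k ?l"
    using k by (metis append_Nil2 diff_is_0_eq take_0 take_append)
  moreover have "take k (map \<xi> [0..<length w]) = map \<xi> [0..<k]"
    using \<open>k \<le> length w\<close> by (simp add: take_map take_upt)
  ultimately show "prefix (map \<xi> [0..<k]) w"
    using prefix_order.trans[OF take_is_prefix \<open>prefix ?l w\<close>, of k] by simp
next
  assume p: "prefix (map \<xi> [0..<k]) w"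
  then have k: "k \<le> length w" using prefix_length_le[OF p] by simp
  then have "map \<xi> [0..<k] = take k (map \<xi> [0..<length w])"
    by (simp add: take_map take_upt)
  then have "prefix (map \<xi> [0..<k]) (map \<xi> [0..<length w])"
    by (metis take_is_prefix)
  then have "prefix (map \<xi> [0..<k]) (longest_common_prefix w (map \<xi> [0..<length w]))"
    using p longest_common_prefix_max_prefix by blast
  then show "k \<le> common_prefix_length w \<xi>"
    using prefix_length_le[of "map \<xi> [0..<k]"] by (simp add: common_prefix_length_def)
qed

lemma converges_to_iff:
  "converges_to \<omega> \<xi> \<longleftrightarrow>
    filterlim (\<lambda>n. common_prefix_length (pos n \<omega>) \<xi>) at_top sequentially"
  by (simp add: filterlim_at_top le_common_prefix_length_iff converges_to_def eventually_prefix_def)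

end


section \<open>The walk on the space of increments\<close>

locale free_product_random_walk = free_product_family I G
  for I :: "'i set" and G :: "'i \<Rightarrow> ('a, 'b) monoid_scheme" +
  fixes \<mu> :: "('i \<times> 'a) pmf"
  assumes set_pmf_mu: "set_pmf \<mu> \<subseteq> alphabet I G"
    and irreducible: "(\<Union>n\<in>{1..}. set_pmf (conv_power (free_product I G) (map_pmf (\<lambda>a. [a]) \<mu>) n))
           = carrier (free_product I G)"
begin

text \<open>The space is cut down to the finite alphabet because, over an uncountable type of letters, the
  positions of the walk need not be measurable for the product of the full discrete sigma-algebras.\<close>

definition step_law :: "('i \<times> 'a) measure" where
  "step_law = point_measure \<Sigma> (\<lambda>a. ennreal (pmf \<mu> a))"

lemma space_step_law [simp]: "space step_law = \<Sigma>"
  and sets_step_law: "sets step_law = Pow \<Sigma>"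
  and sets_step_law_cong [measurable_cong]: "sets step_law = sets (count_space \<Sigma>)"
  by (simp_all add: step_law_def space_point_measure sets_point_measure)

lemma prob_space_step_law: "prob_space step_law"
proof
  have "(\<Sum>a\<in>\<Sigma>. pmf \<mu> a) = 1" by (rule sum_pmf_eq_1) (use set_pmf_mu in auto)
  then show "emeasure step_law (space step_law) = 1"
    by (simp add: step_law_def emeasure_point_measure_finite space_point_measure sum_ennreal)
qed

sublocale W: sequence_space step_law
proof -
  interpret prob_space step_law by (rule prob_space_step_law)
  show "sequence_space step_law" by unfold_locales
qed

abbreviation P :: "(nat \<Rightarrow> 'i \<times> 'a) measure" where "P \<equiv> \<Pi>\<^sub>M i\<in>(UNIV :: nat set). step_law"

lemma space_P [simp]: "space P = letter_seqs"
  by (auto simp: space_PiM PiE_UNIV_domain)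

lemma measurable_pos [measurable]: "pos n \<in> measurable P (count_space UNIV)"
proof (induction n)
  case (Suc n)
  have "(\<lambda>\<omega>. pos n \<omega> \<odot> [\<omega> n]) \<in> measurable P (count_space UNIV)"
  \<comment> \<open>The last increment has finitely many possible values. Fixing it leaves a
    function of the previous position alone, which is measurable by the induction
    hypothesis.\<close>
  proof (rule measurable_compose_countable'[where f = "\<lambda>a \<omega>. pos n \<omega> \<odot> [a]" and I = \<Sigma>])
    show "(\<lambda>\<omega>. pos n \<omega> \<odot> [a]) \<in> measurable P (count_space UNIV)" for a
      using measurable_compose[OF Suc, of "\<lambda>w. w \<odot> [a]" "count_space UNIV"] by simp
    have "(\<lambda>\<omega>. \<omega> n) \<in> measurable P step_law"
      by (rule measurable_component_singleton) simp
    then show "(\<lambda>\<omega>. \<omega> n) \<in> measurable P (count_space \<Sigma>)"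
      unfolding measurable_cong_sets[OF refl sets_step_law_cong] .
    show "countable \<Sigma>" by (simp add: countable_finite)
  qed
  then show ?case by (simp only: pos_Suc)
qed simp

lemma measurable_pos_pred [measurable]: "Measurable.pred P (\<lambda>\<omega>. Q (pos n \<omega>))"
  using measurable_compose[OF measurable_pos, of Q "count_space UNIV"] by simp

lemma pred_event [simp]: "Measurable.pred P D \<Longrightarrow> {\<omega> \<in> letter_seqs. D \<omega>} \<in> sets P"
  by (simp add: pred_def)

lemma measurable_eventually_prefix [measurable]: "Measurable.pred P (eventually_prefix u)"
  unfolding eventually_prefix_def eventually_sequentially by measurable

text \<open>Concatenation at time \<open>n\<close> maps the product of two copies of
  \<open>P\<close> to \<open>P\<close>. By the last hypothesis the preimage of the event
  \<open>D\<close> is a rectangle, whose measure factorises.\<close>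

lemma prob_past_future:
  assumes [measurable]: "Measurable.pred P D" "Measurable.pred P E" "Measurable.pred P F"
    and *: "\<And>\<omega> \<omega>'. \<omega> \<in> letter_seqs \<Longrightarrow> \<omega>' \<in> letter_seqs \<Longrightarrow> D (comb_seq n \<omega> \<omega>') \<longleftrightarrow> E \<omega> \<and> F \<omega>'"
  shows "\<P>(\<omega> in P. D \<omega>) = \<P>(\<omega> in P. E \<omega>) * \<P>(\<omega> in P. F \<omega>)"
proof -
  have "emeasure P {\<omega> \<in> space P. D \<omega>} =
      emeasure (distr (P \<Otimes>\<^sub>M P) P (\<lambda>(\<omega>, \<omega>'). comb_seq n \<omega> \<omega>')) {\<omega> \<in> space P. D \<omega>}"
    by (simp only: W.PiM_comb_seq)
  also have "\<dots> = emeasure (P \<Otimes>\<^sub>M P) ((\<lambda>(\<omega>, \<omega>'). comb_seq n \<omega> \<omega>') -` {\<omega> \<in> space P. D \<omega>} \<inter> space (P \<Otimes>\<^sub>M P))"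
    by (rule emeasure_distr) (auto intro: measurable_comb_seq)
  also have "(\<lambda>(\<omega>, \<omega>'). comb_seq n \<omega> \<omega>') -` {\<omega> \<in> space P. D \<omega>} \<inter> space (P \<Otimes>\<^sub>M P) =
      {\<omega> \<in> space P. E \<omega>} \<times> {\<omega> \<in> space P. F \<omega>}"
    using * by (auto simp: space_pair_measure comb_seq_def Pi_iff)
  also have "emeasure (P \<Otimes>\<^sub>M P) \<dots> = emeasure P {\<omega> \<in> space P. E \<omega>} * emeasure P {\<omega> \<in> space P. F \<omega>}"
    by (rule W.P.emeasure_pair_measure_Times) measurable
  finally show ?thesis
    by (simp add: measure_def enn2real_mult)
qed

text \<open>Invariance of \<open>P\<close> under the shift, obtained from
  \<open>prob_past_future\<close> with a trivial event for the past.\<close>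

lemma AE_future:
  assumes [measurable]: "Measurable.pred P F" and "AE \<omega> in P. F \<omega>"
  shows "AE \<omega> in P. F (\<lambda>k. \<omega> (n + k))"
proof -
  have "(\<lambda>\<omega> k. \<omega> (n + k)) \<in> measurable P P"
    by (rule measurable_PiM_single') (auto intro: measurable_component_singleton simp: Pi_iff)
  then have [measurable]: "Measurable.pred P (\<lambda>\<omega>. F (\<lambda>k. \<omega> (n + k)))"
    by (rule measurable_compose) (rule assms(1))
  have "\<P>(\<omega> in P. F (\<lambda>k. \<omega> (n + k))) = \<P>(\<omega> in P. True) * \<P>(\<omega> in P. F \<omega>)"
    by (rule prob_past_future[where n = n]) (auto simp: comb_seq_def)
  moreover have "\<P>(\<omega> in P. F \<omega>) = 1"
    using assms by (subst W.P.prob_Collect_eq_1) auto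
  ultimately show ?thesis
    using W.P.prob_space by (subst W.P.prob_Collect_eq_1[symmetric]) auto
qed

text \<open>\<open>P\<close> is the law of a sequence of law \<open>P\<close> with an independent
  letter put in front. Integrating over that letter is a finite sum because the alphabet is
  finite.\<close>

lemma prob_first_step:
  assumes [measurable]: "Measurable.pred P D" "\<And>u. u \<in> \<Sigma> \<Longrightarrow> Measurable.pred P (F u)"
    and *: "\<And>u \<omega>. u \<in> \<Sigma> \<Longrightarrow> \<omega> \<in> letter_seqs \<Longrightarrow> D (case_nat u \<omega>) \<longleftrightarrow> F u \<omega>"
  shows "\<P>(\<omega> in P. D \<omega>) = (\<Sum>u\<in>\<Sigma>. pmf \<mu> u * \<P>(\<omega> in P. F u \<omega>))"
proof -
  have m: "(\<lambda>(s, \<omega>). case_nat s \<omega>) \<in> measurable (step_law \<Otimes>\<^sub>M P) P"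
    by measurable
  have "emeasure P {\<omega> \<in> space P. D \<omega>} =
      emeasure (distr (step_law \<Otimes>\<^sub>M P) P (\<lambda>(s, \<omega>). case_nat s \<omega>)) {\<omega> \<in> space P. D \<omega>}"
    by (simp only: W.PiM_iter)
  also have "\<dots> = emeasure (step_law \<Otimes>\<^sub>M P) ((\<lambda>(s, \<omega>). case_nat s \<omega>) -` {\<omega> \<in> space P. D \<omega>} \<inter> space (step_law \<Otimes>\<^sub>M P))"
    by (rule emeasure_distr[OF m]) simp
  also have "\<dots> = (\<integral>\<^sup>+u. emeasure P (Pair u -` ((\<lambda>(s, \<omega>). case_nat s \<omega>) -` {\<omega> \<in> space P. D \<omega>} \<inter> space (step_law \<Otimes>\<^sub>M P))) \<partial>step_law)"
    by (rule W.P.emeasure_pair_measure_alt, rule measurable_sets[OF m]) simp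
  also have "\<dots> = (\<Sum>u\<in>\<Sigma>. ennreal (pmf \<mu> u) * emeasure P (Pair u -` ((\<lambda>(s, \<omega>). case_nat s \<omega>) -` {\<omega> \<in> space P. D \<omega>} \<inter> space (step_law \<Otimes>\<^sub>M P))))"
    unfolding step_law_def by (rule nn_integral_point_measure_finite) simp
  also have "\<dots> = (\<Sum>u\<in>\<Sigma>. ennreal (pmf \<mu> u) * emeasure P {\<omega> \<in> space P. F u \<omega>})"
  proof (rule sum.cong[OF refl])
    fix u assume u: "u \<in> \<Sigma>"
    have "Pair u -` ((\<lambda>(s, \<omega>). case_nat s \<omega>) -` {\<omega> \<in> space P. D \<omega>} \<inter> space (step_law \<Otimes>\<^sub>M P)) =
        {\<omega> \<in> space P. F u \<omega>}"
    proof -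
      have "case_nat u \<omega> \<in> letter_seqs \<longleftrightarrow> \<omega> \<in> letter_seqs" for \<omega>
        using u by (simp add: Pi_iff) (metis nat.exhaust old.nat.simps(4,5))
      then show ?thesis using u *[OF u] by (force simp: space_pair_measure)
    qed
    then show "ennreal (pmf \<mu> u) * emeasure P (Pair u -` ((\<lambda>(s, \<omega>). case_nat s \<omega>) -` {\<omega> \<in> space P. D \<omega>} \<inter> space (step_law \<Otimes>\<^sub>M P))) =
        ennreal (pmf \<mu> u) * emeasure P {\<omega> \<in> space P. F u \<omega>}" by simp
  qed
  also have "\<dots> = ennreal (\<Sum>u\<in>\<Sigma>. pmf \<mu> u * \<P>(\<omega> in P. F u \<omega>))"
    unfolding W.P.emeasure_eq_measure
    by (simp add: ennreal_mult[symmetric] sum_ennreal del: space_P)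
  finally show ?thesis
    by (simp add: W.P.emeasure_eq_measure sum_nonneg)
qed

section \<open>Limit and hitting probabilities\<close>

definition limit_prob :: "('i \<times> 'a) list \<Rightarrow> real" where
  "limit_prob u = \<P>(\<omega> in P. eventually_prefix u \<omega>)"

definition hit_prob :: "'i \<times> 'a \<Rightarrow> real" where
  "hit_prob a = \<P>(\<omega> in P. \<exists>n. pos n \<omega> = [a])"

lemma first_hit_event [measurable]:
  "Measurable.pred P (\<lambda>\<omega>. pos n \<omega> = g \<and> (\<forall>m<n. pos m \<omega> \<noteq> g))"
  by measurable

text \<open>An elementary form of the strong Markov property: split according to the value
  \<open>n\<close> of the time of the first visit to \<open>[a]\<close>, apply the Markov property
  at the fixed time \<open>n\<close> to each piece, and sum.\<close>

lemma limit_prob_Cons: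
  assumes a: "a \<in> \<Sigma>" and v: "v \<noteq> []" "fst (hd v) \<noteq> fst a"
  shows "limit_prob (a # v) = hit_prob a * limit_prob v"
proof -
  \<comment> \<open>\<open>T n\<close> is the event that the first visit to \<open>[a]\<close>
    happens at time \<open>n\<close>. It depends on the first \<open>n\<close> increments only, and
    the events are disjoint for different \<open>n\<close>.\<close>
  define T where "T n \<omega> \<longleftrightarrow> pos n \<omega> = [a] \<and> (\<forall>m<n. pos m \<omega> \<noteq> [a])" for n \<omega>
  have T [measurable]: "Measurable.pred P (T n)" for n
    unfolding T_def by (rule first_hit_event)
  have T_unique: "T n \<omega> \<Longrightarrow> T m \<omega> \<Longrightarrow> n = m" for n m \<omega>
    unfolding T_def by (metis linorder_neqE_nat)
  have T_ex: "(\<exists>n. pos n \<omega> = [a]) \<longleftrightarrow> (\<exists>n. T n \<omega>)" for \<omega>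
    unfolding T_def using exists_least_iff[of "\<lambda>n. pos n \<omega> = [a]"] by blast
  have sums: "(\<lambda>n. \<P>(\<omega> in P. T n \<omega> \<and> Q \<omega>)) sums \<P>(\<omega> in P. (\<exists>n. T n \<omega>) \<and> Q \<omega>)"
    if [measurable]: "Measurable.pred P Q" for Q
  proof -
    have "(\<lambda>n. measure P {\<omega> \<in> space P. T n \<omega> \<and> Q \<omega>}) sums measure P (\<Union>n. {\<omega> \<in> space P. T n \<omega> \<and> Q \<omega>})"
    proof (rule W.P.finite_measure_UNION)
      show "range (\<lambda>n. {\<omega> \<in> space P. T n \<omega> \<and> Q \<omega>}) \<subseteq> sets P"
        by (auto simp del: space_P)
      show "disjoint_family (\<lambda>n. {\<omega> \<in> space P. T n \<omega> \<and> Q \<omega>})"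
        using T_unique by (auto simp: disjoint_family_on_def)
    qed
    moreover have "(\<Union>n. {\<omega> \<in> space P. T n \<omega> \<and> Q \<omega>}) = {\<omega> \<in> space P. (\<exists>n. T n \<omega>) \<and> Q \<omega>}"
      by auto
    ultimately show ?thesis by simp
  qed
  \<comment> \<open>As \<open>v\<close> is nonempty, words with prefix \<open>a # v\<close> have at
    least two letters, so they lie strictly inside the cone and \<open>[a]\<close> was visited
    before.\<close>
  have through: "\<exists>n. pos n \<omega> = [a]" if \<omega>: "\<omega> \<in> letter_seqs" and ev: "eventually_prefix (a # v) \<omega>" for \<omega>
  proof -
    obtain n where n: "prefix (a # v) (pos n \<omega>)"
      using ev unfolding eventually_prefix_def eventually_sequentially by blast
    then have "2 \<le> length (pos n \<omega>)"
      using v(1) prefix_length_le[OF n] by (cases v) auto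
    moreover have "hd (pos n \<omega>) = a" using n by (auto simp: prefix_def)
    ultimately show ?thesis using cone_entered_through_apex[OF \<omega>] by blast
  qed
  have "\<P>(\<omega> in P. (\<exists>n. T n \<omega>) \<and> eventually_prefix (a # v) \<omega>) = limit_prob (a # v)"
    unfolding limit_prob_def using through T_ex by (intro arg_cong[of _ _ "measure P"]) auto
  then have 1: "(\<lambda>n. \<P>(\<omega> in P. T n \<omega> \<and> eventually_prefix (a # v) \<omega>)) sums limit_prob (a # v)"
    using sums[OF measurable_eventually_prefix, of "a # v"] by simp
  have "\<P>(\<omega> in P. T n \<omega> \<and> eventually_prefix (a # v) \<omega>) = \<P>(\<omega> in P. T n \<omega>) * limit_prob v" for n
    unfolding limit_prob_def
  proof (rule prob_past_future[where n = n])
    fix \<omega> \<omega>' assume \<omega>: "\<omega> \<in> letter_seqs" "\<omega>' \<in> letter_seqs"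
    have "pos m (comb_seq n \<omega> \<omega>') = pos m \<omega>" if "m \<le> n" for m
      by (rule pos_cong) (use that in \<open>simp add: comb_seq_def\<close>)
    then have "T n (comb_seq n \<omega> \<omega>') \<longleftrightarrow> T n \<omega>" by (auto simp: T_def)
    \<comment> \<open>On \<open>T n\<close> the later positions are \<open>[a]\<close> times those
      of the fresh walk, and \<open>prefix_single_mult_same\<close> strips the letter
      \<open>a\<close>.\<close>
    moreover have "eventually_prefix (a # v) (comb_seq n \<omega> \<omega>') \<longleftrightarrow> eventually_prefix v \<omega>'" if "T n \<omega>"
    proof -
      have "prefix (a # v) (pos (n + m) (comb_seq n \<omega> \<omega>')) \<longleftrightarrow> prefix v (pos m \<omega>')" for m
        using that prefix_single_mult_same[OF a pos_closed[OF \<omega>(2)] v]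
        unfolding pos_comb_seq[OF \<omega>] T_def by simp
      then show ?thesis
        unfolding eventually_prefix_shift[of "a # v" _ n] by (simp add: eventually_prefix_def)
    qed
    ultimately show "T n (comb_seq n \<omega> \<omega>') \<and> eventually_prefix (a # v) (comb_seq n \<omega> \<omega>') \<longleftrightarrow>
        T n \<omega> \<and> eventually_prefix v \<omega>'" by blast
  qed measurable
  moreover have "(\<lambda>n. \<P>(\<omega> in P. T n \<omega>) * limit_prob v) sums (hit_prob a * limit_prob v)"
    using sums[of "\<lambda>_. True"] unfolding hit_prob_def T_ex by (intro sums_mult2) simp
  ultimately show ?thesis using 1 sums_unique2 by simp
qed

lemma prob_pos_1: "s \<in> \<Sigma> \<Longrightarrow> \<P>(\<omega> in P. pos 1 \<omega> = [s]) = pmf \<mu> s"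
proof -
  assume s: "s \<in> \<Sigma>"
  have "\<P>(\<omega> in P. pos 1 \<omega> = [s]) = (\<Sum>u\<in>\<Sigma>. pmf \<mu> u * \<P>(\<omega> in P. u = s))"
  proof (rule prob_first_step)
    show "pos 1 (case_nat u \<omega>) = [s] \<longleftrightarrow> u = s" if "u \<in> \<Sigma>" "\<omega> \<in> letter_seqs" for u \<omega>
      using pos_case_nat[OF that, of 0] by simp
  qed measurable
  also have "\<dots> = (\<Sum>u\<in>\<Sigma>. if u = s then pmf \<mu> s else 0)"
    by (intro sum.cong refl) (use W.P.prob_space in auto)
  finally show ?thesis using s by simp
qed

text \<open>Links the convolution powers, in which irreducibility is stated, to the walk on
  \<open>P\<close>. Following one path to \<open>h\<close> and then taking the increment
  \<open>s\<close> gives a positive lower bound.\<close>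

lemma prob_pos_positive:
  "g \<in> set_pmf (conv_power (free_product I G) (map_pmf (\<lambda>a. [a]) \<mu>) n) \<Longrightarrow> \<P>(\<omega> in P. pos n \<omega> = g) > 0"
proof (induction n arbitrary: g)
  case 0
  then show ?case using W.P.prob_space by simp
next
  case (Suc n)
  then obtain h s where h: "h \<in> set_pmf (conv_power (free_product I G) (map_pmf (\<lambda>a. [a]) \<mu>) n)"
    and s: "s \<in> set_pmf \<mu>" and g: "g = h \<odot> [s]"
    by (auto simp del: foldr_Cons)
  have s': "s \<in> \<Sigma>" using s set_pmf_mu by blast
  have "0 < \<P>(\<omega> in P. pos n \<omega> = h) * pmf \<mu> s"
    using Suc.IH[OF h] s by (simp add: pmf_positive)
  also have "\<dots> = \<P>(\<omega> in P. pos n \<omega> = h) * \<P>(\<omega> in P. pos 1 \<omega> = [s])"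
    by (simp only: prob_pos_1[OF s'])
  also have "\<dots> \<le> \<P>(\<omega> in P. pos n \<omega> = h) * \<P>(\<omega> in P. h \<odot> pos 1 \<omega> = g)"
    by (intro mult_left_mono W.P.finite_measure_mono) (auto simp: g simp del: space_P foldr_Cons)
  also have "\<dots> = \<P>(\<omega> in P. pos n \<omega> = h \<and> pos (n + 1) \<omega> = g)"
  proof (rule prob_past_future[where n = n, symmetric])
    fix \<omega> \<omega>' assume \<omega>: "\<omega> \<in> letter_seqs" "\<omega>' \<in> letter_seqs"
    have "pos n (comb_seq n \<omega> \<omega>') = pos n \<omega>"
      by (rule pos_cong) (simp add: comb_seq_def)
    then show "pos n (comb_seq n \<omega> \<omega>') = h \<and> pos (n + 1) (comb_seq n \<omega> \<omega>') = g \<longleftrightarrow>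
        pos n \<omega> = h \<and> h \<odot> pos 1 \<omega>' = g"
      unfolding pos_comb_seq[OF \<omega>] by auto
  qed measurable
  also have "\<dots> \<le> \<P>(\<omega> in P. pos (n + 1) \<omega> = g)"
    by (intro W.P.finite_measure_mono) (auto simp del: space_P)
  finally show ?case by simp
qed

lemma hit_prob_positive: "a \<in> \<Sigma> \<Longrightarrow> hit_prob a > 0"
proof -
  assume "a \<in> \<Sigma>"
  then have "[a] \<in> (\<Union>n\<in>{1..}. set_pmf (conv_power (free_product I G) (map_pmf (\<lambda>a. [a]) \<mu>) n))"
    unfolding irreducible by simp
  then obtain n where "[a] \<in> set_pmf (conv_power (free_product I G) (map_pmf (\<lambda>a. [a]) \<mu>) n)" by blast
  from prob_pos_positive[OF this] have "0 < \<P>(\<omega> in P. pos n \<omega> = [a])" .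
  also have "\<dots> \<le> hit_prob a"
    unfolding hit_prob_def by (intro W.P.finite_measure_mono) (auto simp del: space_P)
  finally show ?thesis .
qed

end

section \<open>Almost sure convergence of the transient walk\<close>

locale transient_free_product_random_walk = free_product_random_walk I G \<mu>
  for I :: "'i set" and G :: "'i \<Rightarrow> ('a, 'b) monoid_scheme" and \<mu> :: "('i \<times> 'a) pmf" +
  assumes transient: "AE \<omega> in P. finite {n. pos n \<omega> = []}"
begin

text \<open>Transience is given at the neutral element. If \<open>g\<close> is visited at time
  \<open>n\<close>, later visits to \<open>g\<close> are returns to the neutral element of the walk
  restarted at time \<open>n\<close>, and almost surely all the countably many restarted walks
  return finitely often.\<close>

lemma AE_escaping: "AE \<omega> in P. escaping \<omega>"
proof -
  have [measurable]: "Measurable.pred P (\<lambda>\<omega>. finite {n. pos n \<omega> = []})"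
    unfolding finite_nat_set_iff_bounded by simp measurable
  have "AE \<omega> in P. \<forall>n. finite {m. pos m (\<lambda>k. \<omega> (n + k)) = []}"
    unfolding AE_all_countable by (intro allI AE_future[OF _ transient]) measurable
  then show ?thesis
  proof (rule AE_mp, intro AE_I2 impI)
    fix \<omega> assume \<omega>: "\<omega> \<in> space P" and fin: "\<forall>n. finite {m. pos m (\<lambda>k. \<omega> (n + k)) = []}"
    show "escaping \<omega>"
      unfolding escaping_def
    proof
      fix g assume g: "g \<in> L"
      show "finite {n. pos n \<omega> = g}"
      proof (cases "\<exists>n. pos n \<omega> = g")
        case False
        then show ?thesis by simp
      next
        case True
        then obtain n where n: "pos n \<omega> = g" by blast
        let ?\<omega>' = "\<lambda>k. \<omega> (n + k)"
        have \<omega>': "\<omega> \<in> letter_seqs" "?\<omega>' \<in> letter_seqs" using \<omega> by auto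
        have comb: "comb_seq n \<omega> ?\<omega>' = \<omega>" by (auto simp: comb_seq_def)
        have "pos m ?\<omega>' = []" if "pos (n + m) \<omega> = g" for m
        proof -
          have "g \<odot> pos m ?\<omega>' = g" using pos_comb_seq[OF \<omega>', of n m] that n comb by simp
          then show ?thesis using H.l_cancel_one[of g "pos m ?\<omega>'"] g \<omega>' by auto
        qed
        then have "m < n \<or> m \<in> (+) n ` {m. pos m ?\<omega>' = []}" if "pos m \<omega> = g" for m
          using that by (cases "m < n") (auto simp: not_less dest!: le_Suc_ex)
        then have "{m. pos m \<omega> = g} \<subseteq> {..<n} \<union> (+) n ` {m. pos m ?\<omega>' = []}"
          by blast
        then show ?thesis by (rule finite_subset) (use fin in auto)
      qed
    qed
  qed
qed

lemma AE_eventually_prefix: "AE \<omega> in P. \<omega> \<in> letter_seqs \<and> (\<forall>k. \<exists>u. length u = k \<and> eventually_prefix u \<omega>)"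
  using AE_escaping by (rule AE_mp) (intro AE_I2 impI conjI allI escaping_eventually_prefix, simp_all only: space_P)

lemma sum_limit_prob_Nil: "(\<Sum>a\<in>\<Sigma>. limit_prob [a]) = 1"
proof -
  have "\<P>(\<omega> in P. True) = (\<Sum>a\<in>\<Sigma>. \<P>(\<omega> in P. eventually_prefix [a] \<omega>))"
  proof (rule W.P.prob_sum)
    show "AE \<omega> in P. (\<forall>a\<in>\<Sigma>. eventually_prefix [a] \<omega> \<longrightarrow> True) \<and> (True \<longrightarrow> (\<exists>!a\<in>\<Sigma>. eventually_prefix [a] \<omega>))"
      using AE_eventually_prefix
    proof (rule AE_mp, intro AE_I2 impI)
      fix \<omega> assume \<omega>: "\<omega> \<in> letter_seqs \<and> (\<forall>k. \<exists>u. length u = k \<and> eventually_prefix u \<omega>)"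
      then obtain u where u: "length u = 1" "eventually_prefix u \<omega>" by blast
      then obtain a where a: "u = [a]" by (cases u) auto
      have "a \<in> \<Sigma>" using eventually_prefix_reduced[of \<omega> u] \<omega> u a by (simp add: reduced_Cons)
      moreover have "c = a" if "eventually_prefix [c] \<omega>" for c
        using eventually_prefix_unique[OF that u(2)] a by simp
      ultimately show "(\<forall>a\<in>\<Sigma>. eventually_prefix [a] \<omega> \<longrightarrow> True) \<and> (True \<longrightarrow> (\<exists>!a\<in>\<Sigma>. eventually_prefix [a] \<omega>))"
        using u(2) unfolding a by blast
    qed
  qed (auto simp del: space_P)
  then show ?thesis using W.P.prob_space by (simp add: limit_prob_def)
qed

lemma sum_limit_prob_outside:
  assumes "a \<in> \<Sigma>"
  shows "limit_prob [a] = (\<Sum>b\<in>outside a. limit_prob [a, b])"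
  unfolding limit_prob_def
proof (rule W.P.prob_sum)
  show "AE \<omega> in P. (\<forall>b\<in>outside a. eventually_prefix [a, b] \<omega> \<longrightarrow> eventually_prefix [a] \<omega>) \<and>
      (eventually_prefix [a] \<omega> \<longrightarrow> (\<exists>!b\<in>outside a. eventually_prefix [a, b] \<omega>))"
    using AE_eventually_prefix
  proof (rule AE_mp, intro AE_I2 impI conjI ballI)
    fix \<omega> assume \<omega>: "\<omega> \<in> letter_seqs \<and> (\<forall>k. \<exists>u. length u = k \<and> eventually_prefix u \<omega>)"
      and 1: "eventually_prefix [a] \<omega>"
    then obtain u where u: "length u = 2" "eventually_prefix u \<omega>" by blast
    then have "prefix [a] u" using eventually_prefix_comparable[OF 1 u(2)] by simp
    then obtain b where b: "u = [a, b]" using u(1) by (cases u; cases "tl u") auto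
    have "b \<in> \<Sigma>" "fst b \<noteq> fst a"
      using eventually_prefix_reduced[of \<omega> u] \<omega> u b by (simp_all add: reduced_Cons)
    then have "b \<in> outside a" unfolding mem_outside by blast
    moreover have "c = b" if "eventually_prefix [a, c] \<omega>" for c
      using eventually_prefix_unique[OF that u(2)] b by simp
    ultimately show "\<exists>!b\<in>outside a. eventually_prefix [a, b] \<omega>"
      using u(2) unfolding b by blast
  next
    fix \<omega> b assume "eventually_prefix [a, b] \<omega>"
    then show "eventually_prefix [a] \<omega>" by (rule eventually_prefix_mono[rotated]) simp
  qed
qed (auto simp del: space_P)

text \<open>Almost surely the first letter of the position stabilises, so the event says that the
  first letter of the limit has an index different from that of \<open>a\<close>. The event is
  phrased as \<open>prefix_single_mult_self\<close> delivers it after a first increment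
  \<open>a\<close>.\<close>

lemma sum_limit_prob_not_like:
  assumes "a \<in> \<Sigma>"
  shows "\<P>(\<omega> in P. \<forall>\<^sub>F n in sequentially. pos n \<omega> = [] \<or> fst (hd (pos n \<omega>)) \<noteq> fst a) = (\<Sum>b\<in>outside a. limit_prob [b])"
  unfolding limit_prob_def
proof (rule W.P.prob_sum)
  show "AE \<omega> in P. (\<forall>b\<in>outside a. eventually_prefix [b] \<omega> \<longrightarrow> (\<forall>\<^sub>F n in sequentially. pos n \<omega> = [] \<or> fst (hd (pos n \<omega>)) \<noteq> fst a)) \<and>
      ((\<forall>\<^sub>F n in sequentially. pos n \<omega> = [] \<or> fst (hd (pos n \<omega>)) \<noteq> fst a) \<longrightarrow> (\<exists>!b\<in>outside a. eventually_prefix [b] \<omega>))"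
    using AE_eventually_prefix
  proof (rule AE_mp, intro AE_I2 impI conjI ballI)
    fix \<omega> b assume b: "b \<in> outside a" "eventually_prefix [b] \<omega>"
    show "\<forall>\<^sub>F n in sequentially. pos n \<omega> = [] \<or> fst (hd (pos n \<omega>)) \<noteq> fst a"
      using b(2) unfolding eventually_prefix_def
      by (rule eventually_mono) (use b(1)[unfolded mem_outside] in \<open>auto simp: prefix_single_iff\<close>)
  next
    fix \<omega> assume \<omega>: "\<omega> \<in> letter_seqs \<and> (\<forall>k. \<exists>u. length u = k \<and> eventually_prefix u \<omega>)"
      and 1: "\<forall>\<^sub>F n in sequentially. pos n \<omega> = [] \<or> fst (hd (pos n \<omega>)) \<noteq> fst a"
    then obtain u where u: "length u = 1" "eventually_prefix u \<omega>" by blast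
    then obtain b where b: "u = [b]" by (cases u) auto
    have "\<forall>\<^sub>F n in sequentially. (pos n \<omega> = [] \<or> fst (hd (pos n \<omega>)) \<noteq> fst a) \<and> prefix [b] (pos n \<omega>)"
      using 1 u(2) unfolding b eventually_prefix_def by (rule eventually_conj)
    then have "fst b \<noteq> fst a"
      unfolding eventually_sequentially by (auto simp: prefix_single_iff)
    moreover have "b \<in> \<Sigma>"
      using eventually_prefix_reduced[of \<omega> u] \<omega> u b by (simp add: reduced_Cons)
    ultimately have "b \<in> outside a" unfolding mem_outside by blast
    moreover have "c = b" if "eventually_prefix [c] \<omega>" for c
      using eventually_prefix_unique[OF that u(2)] b by simp
    ultimately show "\<exists>!b\<in>outside a. eventually_prefix [b] \<omega>"
      using u(2) unfolding b by blast
  qed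
qed (auto simp del: space_P simp: eventually_sequentially)

end


section \<open>Traffic Equations\<close>

context free_product_family
begin

text \<open>In the second sum of the Traffic Equations \<open>u\<close> determines \<open>v\<close>,
  so that sum over pairs becomes a sum over \<open>u\<close>.\<close>

lemma single_mult_single_eq_iff:
  assumes "a \<in> \<Sigma>" "u \<in> \<Sigma>" "v \<in> \<Sigma>"
  shows "[u] \<odot> [v] = [a] \<longleftrightarrow> fst u = fst a \<and> u \<noteq> a \<and> v = quot u a"
proof (cases "fst u = fst v")
  case False
  then have "[u] \<odot> [v] = [u, v]" unfolding single_mult_Cons by simp
  then show ?thesis using False by auto
next
  case True
  let ?p = "snd u \<otimes>\<^bsub>G (fst u)\<^esub> snd v"
  have "[u] \<odot> [v] = [a] \<longleftrightarrow> ?p \<noteq> \<one>\<^bsub>G (fst u)\<^esub> \<and> (fst u, ?p) = a"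
    unfolding single_mult_Cons using True by auto
  also have "\<dots> \<longleftrightarrow> fst u = fst a \<and> ?p = snd a"
    using assms(1) by (cases a) (auto simp: mem_alphabet)
  also have "\<dots> \<longleftrightarrow> fst u = fst a \<and> u \<noteq> a \<and> v = quot u a"
  proof (cases "fst u = fst a")
    case same: True
    have "?p = snd a \<longleftrightarrow> v = quot u a"
      using letter_mult_eq_iff[OF assms same] True same by simp
    moreover have "?p \<noteq> snd a" if "u = a"
      using letter_mult_neq[OF assms(2,3)] True that by simp
    ultimately show ?thesis using same by blast
  qed simp
  finally show ?thesis .
qed

text \<open>After a first increment \<open>u\<close>, reaching \<open>a # w\<close> means that the
  remaining walk reaches the inverse of \<open>u\<close> times \<open>a # w\<close>. The three cases
  match those of \<open>traffic_equations_iff\<close>.\<close>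

lemma inv_letter_mult_Cons:
  assumes "u \<in> \<Sigma>" "a # w \<in> L"
  shows "[inv_letter u] \<odot> (a # w) =
    (if u = a then w else if fst u = fst a then quot u a # w else inv_letter u # a # w)"
proof -
  have a: "a \<in> \<Sigma>" using assms(2) by (simp add: reduced_Cons)
  have iu: "inv_letter u \<in> \<Sigma>" using assms(1) by blast
  show ?thesis
  proof (cases "fst u = fst a")
    case True
    have "snd (inv_letter u) \<otimes>\<^bsub>G (fst (inv_letter u))\<^esub> snd a = \<one>\<^bsub>G (fst (inv_letter u))\<^esub> \<longleftrightarrow> a = u"
      using letter_mult_one_iff[OF iu a] True assms(1) by simp
    then show ?thesis using True unfolding single_mult_Cons by (auto simp: letter_inv_def)
  next
    case False
    then show ?thesis unfolding single_mult_Cons by auto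
  qed
qed

text \<open>Collects the three sums into one sum over the first increment \<open>u\<close>, which is
  the form produced by \<open>prob_first_step\<close>.\<close>

lemma traffic_equations_iff:
  "traffic_equations I G \<mu> x \<longleftrightarrow>
    (\<forall>a\<in>\<Sigma>. x a = (\<Sum>u\<in>\<Sigma>. pmf \<mu> u *
      (if u = a then sum x (outside a)
       else if fst u = fst a then x (quot u a)
       else x (inv_letter u) / sum x (outside u) * x a)))"
proof -
  have "pmf \<mu> a * sum x (outside a)
      + (\<Sum>(u, v)\<in>{(u, v) \<in> \<Sigma> \<times> \<Sigma>. [u] \<odot> [v] = [a]}. pmf \<mu> u * x v)
      + (\<Sum>u\<in>outside a. pmf \<mu> (inv_letter u) * (x u / sum x (outside u)) * x a) =
    (\<Sum>u\<in>\<Sigma>. pmf \<mu> u *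
      (if u = a then sum x (outside a)
       else if fst u = fst a then x (quot u a)
       else x (inv_letter u) / sum x (outside u) * x a))" (is "?l1 + ?l2 + ?l3 = sum ?t \<Sigma>")
    if a: "a \<in> \<Sigma>" for a
  proof -
    let ?B = "{u \<in> \<Sigma>. fst u = fst a \<and> u \<noteq> a}"
    have "sum ?t \<Sigma> = sum ?t (insert a (?B \<union> outside a))"
      by (rule arg_cong[of _ _ "sum ?t"]) (use a in \<open>auto simp: letters_like_def\<close>)
    also have "\<dots> = ?t a + sum ?t (?B \<union> outside a)"
      by (rule sum.insert) (auto simp: letters_like_def a)
    also have "sum ?t (?B \<union> outside a) = sum ?t ?B + sum ?t (outside a)"
      by (rule sum.union_disjoint) (auto simp: letters_like_def)
    also have "sum ?t ?B = ?l2"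
    proof (rule sum.reindex_bij_witness[where i = fst and j = "\<lambda>u. (u, quot u a)"])
      fix u assume u: "u \<in> ?B"
      then have q: "quot u a \<in> \<Sigma>" using quot_closed[OF a] by blast
      show "(u, quot u a) \<in> {(u, v) \<in> \<Sigma> \<times> \<Sigma>. [u] \<odot> [v] = [a]}"
        using u q single_mult_single_eq_iff[OF a _ q] by simp
      show "(case (u, quot u a) of (u, v) \<Rightarrow> pmf \<mu> u * x v) = ?t u"
        using u by auto
    next
      fix p assume "p \<in> {(u, v) \<in> \<Sigma> \<times> \<Sigma>. [u] \<odot> [v] = [a]}"
      then obtain u v where p: "p = (u, v)" "u \<in> \<Sigma>" "v \<in> \<Sigma>" "[u] \<odot> [v] = [a]" by blast
      then have "fst u = fst a \<and> u \<noteq> a \<and> v = quot u a"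
        using single_mult_single_eq_iff[OF a p(2,3)] by blast
      then show "fst p \<in> ?B" "(fst p, quot (fst p) a) = p" using p by auto
    qed auto
    \<comment> \<open>Substitute the inverse of \<open>u\<close> for \<open>u\<close>, an involution
      that preserves the index and hence \<open>outside u\<close>.\<close>
    also have "sum ?t (outside a) = ?l3"
    proof (rule sum.reindex_bij_witness[where i = inv_letter and j = inv_letter])
      fix u assume "u \<in> outside a"
      then have u: "u \<in> \<Sigma>" "fst u \<noteq> fst a" unfolding mem_outside by auto
      then show "inv_letter u \<in> outside a" unfolding mem_outside by auto
      show "inv_letter (inv_letter u) = u" using u by simp
      have "outside (inv_letter u) = outside u" by (rule outside_cong) simp
      then show "pmf \<mu> (inv_letter (inv_letter u)) * (x (inv_letter u) / sum x (outside (inv_letter u))) * x a = ?t u"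
        using u by auto
    next
      fix u assume "u \<in> outside a"
      then have u: "u \<in> \<Sigma>" "fst u \<noteq> fst a" unfolding mem_outside by auto
      then show "inv_letter u \<in> outside a" unfolding mem_outside by auto
      show "inv_letter (inv_letter u) = u" using u by simp
    qed
    finally show ?thesis by simp
  qed
  then show ?thesis
    unfolding traffic_equations_def mult_H by (intro ball_cong refl) (simp only:)
qed

section \<open>Comparison of probability vectors through their ratios\<close>

lemma sum_outside:
  assumes "sum x \<Sigma> = (1::real)"
  shows "sum x (outside a) = 1 - sum x (letters_like I G a)"
  using assms by (subst sum_diff) (auto simp: letters_like_def)

lemma open_simplex_outside_positive:
  assumes "x \<in> open_simplex \<Sigma>"
  shows "0 < sum x (outside a)"
  using assms exists_outside[of a] by (intro sum_pos) (auto simp: open_simplex_def)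

text \<open>Both vectors have total mass 1, that is the index classes have masses \<open>s / (1 + s)\<close>, where \<open>s\<close>
  is the sum of the ratios over the class, and these add up to 1. As \<open>s / (1 + s)\<close> is strictly
  increasing, there is no room for a strict inequality.\<close>

lemma open_simplex_eqI:
  assumes x: "x \<in> open_simplex \<Sigma>" and y: "y \<in> open_simplex \<Sigma>"
    and le: "\<And>a. a \<in> \<Sigma> \<Longrightarrow> x a / sum x (outside a) \<le> y a / sum y (outside a)"
  shows "x = y"
proof -
  let ?X = "\<lambda>a. sum x (outside a)" and ?Y = "\<lambda>a. sum y (outside a)"
  have sum1: "sum x \<Sigma> = 1" "sum y \<Sigma> = 1" using x y by (auto simp: open_simplex_def)
  have pos: "0 < ?X a" "0 < ?Y a" for a
    using open_simplex_outside_positive x y by auto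
  let ?C = "\<lambda>i. {b \<in> \<Sigma>. fst b = i}"
  have mass: "?X a = 1 - sum x (?C (fst a))" "?Y a = 1 - sum y (?C (fst a))" for a
    using sum_outside[OF sum1(1)] sum_outside[OF sum1(2)] by (simp_all add: letters_like_def)
  have mass_le: "sum x (?C i) \<le> sum y (?C i)" if "i \<in> I" for i
  proof -
    obtain a where a: "a \<in> \<Sigma>" "fst a = i" using exists_letter[OF \<open>i \<in> I\<close>] by blast
    have oc: "outside b = outside a" if "b \<in> ?C i" for b
      by (rule outside_cong) (use that a in auto)
    have "sum x (?C i) / ?X a = (\<Sum>b\<in>?C i. x b / ?X b)"
      unfolding sum_divide_distrib by (rule sum.cong) (simp_all only: oc)
    also have "\<dots> \<le> (\<Sum>b\<in>?C i. y b / ?Y b)"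
      by (intro sum_mono le) auto
    also have "\<dots> = sum y (?C i) / ?Y a"
      unfolding sum_divide_distrib by (rule sum.cong) (simp_all only: oc)
    finally have "sum x (?C i) / ?X a \<le> sum y (?C i) / ?Y a" .
    \<comment> \<open>With \<open>?X a\<close> and \<open>?Y a\<close> written as one minus the
      class mass, the products of the two masses cancel.\<close>
    then have "sum x (?C i) * ?Y a \<le> sum y (?C i) * ?X a"
      using pos[of a] by (simp add: field_simps)
    then show ?thesis unfolding mass a(2) by (simp add: algebra_simps)
  qed
  have group: "(\<Sum>i\<in>I. sum z (?C i)) = sum z \<Sigma>" for z :: "'i \<times> 'a \<Rightarrow> real"
    by (rule sum.group) (use finite_I in \<open>auto simp: mem_alphabet\<close>)
  have mass_eq: "sum x (?C i) = sum y (?C i)" if "i \<in> I" for i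
    using sum_mono_inv[of "\<lambda>i. sum x (?C i)" I "\<lambda>i. sum y (?C i)" i] group sum1 mass_le that finite_I by simp
  have "x a \<le> y a" if a: "a \<in> \<Sigma>" for a
  proof -
    \<comment> \<open>Equal class masses make the denominators equal, so the ratio bound becomes a
      bound between coordinates. The equal total masses then exclude strict inequality.\<close>
    have "?X a = ?Y a" unfolding mass using mass_eq a by (simp add: mem_alphabet)
    then show ?thesis using le[OF a] pos[of a] by (simp add: divide_le_cancel)
  qed
  then have "x a = y a" if "a \<in> \<Sigma>" for a
    using sum_mono_inv[of x \<Sigma> y a] sum1 that by simp
  then show ?thesis using x y by (auto simp: open_simplex_def intro: extensionalityI)
qed

end

section \<open>Minimality of the hitting probabilities\<close>

context free_product_random_walk
begin

text \<open>The hitting probabilities form the least solution of the equations satisfied by the ratios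
  \<open>x a / sum x (outside a)\<close> of a solution \<open>x\<close> of the Traffic Equations.\<close>

lemma hit_prob_le:
  assumes x: "x \<in> open_simplex \<Sigma>" and tr: "traffic_equations I G \<mu> x" and a: "a \<in> \<Sigma>"
  shows "hit_prob a \<le> x a / sum x (outside a)"
proof -
  define q where "q a = x a / sum x (outside a)" for a
  have pos: "0 < sum x (outside a)" for a
    using open_simplex_outside_positive[OF x] .
  have q_pos: "0 < q a" if "a \<in> \<Sigma>" for a
    unfolding q_def by (rule divide_pos_pos[OF _ pos]) (use x that in \<open>simp add: open_simplex_def\<close>)
  have q_eq: "q a = (\<Sum>u\<in>\<Sigma>. pmf \<mu> u * (if u = a then 1 else if fst u = fst a then q (quot u a) else q (inv_letter u) * q a))"
    if a: "a \<in> \<Sigma>" for a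
  proof -
    have "x a / sum x (outside a) = (\<Sum>u\<in>\<Sigma>. pmf \<mu> u *
      (if u = a then sum x (outside a)
       else if fst u = fst a then x (quot u a)
       else x (inv_letter u) / sum x (outside u) * x a)) / sum x (outside a)"
      by (rule arg_cong[of _ _ "\<lambda>z. z / sum x (outside a)"])
        (rule bspec[OF tr[unfolded traffic_equations_iff] a])
    also have "\<dots> = (\<Sum>u\<in>\<Sigma>. pmf \<mu> u * (if u = a then 1 else if fst u = fst a then q (quot u a) else q (inv_letter u) * q a))"
      unfolding sum_divide_distrib
    proof (rule sum.cong[OF refl])
      fix u
      \<comment> \<open>\<open>quot u a\<close> has the index of \<open>a\<close> and the inverse
        letter that of \<open>u\<close>, so after division by \<open>sum x (outside a)\<close> every
        factor is again a ratio \<open>q\<close>.\<close>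
      have "outside (quot u a) = outside a" "outside (inv_letter u) = outside u"
        by (rule outside_cong, simp)+
      then show "pmf \<mu> u *
        (if u = a then sum x (outside a)
         else if fst u = fst a then x (quot u a)
         else x (inv_letter u) / sum x (outside u) * x a) / sum x (outside a) =
        pmf \<mu> u * (if u = a then 1 else if fst u = fst a then q (quot u a) else q (inv_letter u) * q a)"
        using pos[of a] unfolding q_def by simp
    qed
    finally show ?thesis by (simp only: q_def)
  qed
  \<comment> \<open>Steps of the walk lead from letters to longer words, so the bound has to be
    proved for all words. The multiplicative extension of \<open>q\<close> satisfies the first-step
    equation at every nonempty word.\<close>
  define Q where "Q w = (\<Prod>b\<leftarrow>w. q b)" for w
  have Q_nonneg: "0 \<le> Q w" if "w \<in> L" for w
    using that by (induction w) (simp_all add: Q_def reduced_Cons mult_nonneg_nonneg less_imp_le[OF q_pos])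
  \<comment> \<open>Induction on the time horizon: at horizon 0 the hitting probability is the
    indicator of the empty word, which is below \<open>Q\<close>, and the first-step equation
    carries the bound to the next horizon.\<close>
  have "\<P>(\<omega> in P. \<exists>m\<le>n. pos m \<omega> = g) \<le> Q g" if "g \<in> L" for n g
    using that
  proof (induction n arbitrary: g)
    case 0
    have "Q [] = 1" by (simp add: Q_def)
    then show ?case using W.P.prob_le_1 Q_nonneg[OF 0] by (cases "g = []") simp_all
  next
    case (Suc n)
    show ?case
    proof (cases g)
      case Nil
      then show ?thesis using W.P.prob_le_1 by (simp add: Q_def)
    next
      case (Cons b w)
      then have b: "b \<in> \<Sigma>" using Suc.prems by (simp add: reduced_Cons)
      have "\<P>(\<omega> in P. \<exists>m\<le>Suc n. pos m \<omega> = g) =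
          (\<Sum>u\<in>\<Sigma>. pmf \<mu> u * \<P>(\<omega> in P. \<exists>m\<le>n. pos m \<omega> = [inv_letter u] \<odot> g))"
      proof (rule prob_first_step)
        fix u \<omega> assume u: "u \<in> \<Sigma>" and \<omega>: "\<omega> \<in> letter_seqs"
        have step: "pos (Suc m) (case_nat u \<omega>) = g \<longleftrightarrow> pos m \<omega> = [inv_letter u] \<odot> g" for m
          unfolding pos_case_nat[OF u \<omega>]
          by (rule single_mult_eq_iff) (use u \<omega> Suc.prems in auto)
        \<comment> \<open>Time 0 does not count, because the target \<open>g\<close> is nonempty
          here while the walk starts at the empty word.\<close>
        have "(\<exists>m\<le>Suc n. pos m (case_nat u \<omega>) = g) \<longleftrightarrow> (\<exists>m\<le>n. pos (Suc m) (case_nat u \<omega>) = g)"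
          using Cons by (metis Suc_le_mono list.distinct(1) not0_implies_Suc pos_0)
        then show "(\<exists>m\<le>Suc n. pos m (case_nat u \<omega>) = g) \<longleftrightarrow> (\<exists>m\<le>n. pos m \<omega> = [inv_letter u] \<odot> g)"
          unfolding step .
      qed measurable
      also have "\<dots> \<le> (\<Sum>u\<in>\<Sigma>. pmf \<mu> u * Q ([inv_letter u] \<odot> g))"
      proof (intro sum_mono mult_left_mono Suc.IH)
        show "[inv_letter u] \<odot> g \<in> L" if "u \<in> \<Sigma>" for u
          by (rule mul_closed) (use that Suc.prems in auto)
      qed simp
      also have "\<dots> = (\<Sum>u\<in>\<Sigma>. pmf \<mu> u * (if u = b then 1 else if fst u = fst b then q (quot u b) else q (inv_letter u) * q b)) * Q w"
        unfolding sum_distrib_right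
      proof (rule sum.cong[OF refl])
        fix u assume "u \<in> \<Sigma>"
        from inv_letter_mult_Cons[OF this Suc.prems[unfolded Cons]]
        show "pmf \<mu> u * Q ([inv_letter u] \<odot> g) = pmf \<mu> u * (if u = b then 1 else if fst u = fst b then q (quot u b) else q (inv_letter u) * q b) * Q w"
          unfolding Cons by (simp only:) (simp add: Q_def)
      qed
      also have "\<dots> = Q g" using q_eq[OF b] by (simp add: Cons Q_def)
      finally show ?thesis .
    qed
  qed
  from this[of "[a]"] have le: "\<P>(\<omega> in P. \<exists>m\<le>n. pos m \<omega> = [a]) \<le> q a" for n
    using a by (simp add: Q_def)
  \<comment> \<open>The horizon tends to infinity, by continuity from below.\<close>
  have "(\<lambda>n. measure P {\<omega> \<in> space P. \<exists>m\<le>n. pos m \<omega> = [a]}) \<longlonglongrightarrow> measure P (\<Union>n. {\<omega> \<in> space P. \<exists>m\<le>n. pos m \<omega> = [a]})"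
  proof (rule W.P.finite_Lim_measure_incseq)
    show "range (\<lambda>n. {\<omega> \<in> space P. \<exists>m\<le>n. pos m \<omega> = [a]}) \<subseteq> sets P"
      by (auto simp del: space_P)
    show "incseq (\<lambda>n. {\<omega> \<in> space P. \<exists>m\<le>n. pos m \<omega> = [a]})"
      by (auto simp: incseq_def) (meson le_trans)
  qed
  then have "measure P (\<Union>n. {\<omega> \<in> space P. \<exists>m\<le>n. pos m \<omega> = [a]}) \<le> q a"
    using le by (intro LIMSEQ_le_const2) auto
  moreover have "(\<Union>n. {\<omega> \<in> space P. \<exists>m\<le>n. pos m \<omega> = [a]}) = {\<omega> \<in> space P. \<exists>n. pos n \<omega> = [a]}"
    by auto
  ultimately show ?thesis by (simp add: hit_prob_def q_def)
qed

end

section \<open>The solution given by the first letter of the limit\<close>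

context transient_free_product_random_walk
begin

text \<open>Restricted to the alphabet because the elements of \<open>open_simplex\<close> are
  extensional functions.\<close>

definition rate :: "'i \<times> 'a \<Rightarrow> real" where
  "rate = (\<lambda>a\<in>\<Sigma>. limit_prob [a])"

lemma rate_eq: "a \<in> \<Sigma> \<Longrightarrow> rate a = limit_prob [a]"
  by (simp add: rate_def)

text \<open>Sum over the second letter of the limit and apply \<open>limit_prob_Cons\<close> to each
  two-letter word.\<close>

lemma rate_hit_prob:
  assumes a: "a \<in> \<Sigma>" shows "rate a = hit_prob a * sum rate (outside a)"
proof -
  have "rate a = (\<Sum>b\<in>outside a. limit_prob [a, b])"
    using sum_limit_prob_outside[OF a] a by (simp only: rate_eq)
  also have "\<dots> = (\<Sum>b\<in>outside a. hit_prob a * rate b)"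
  proof (rule sum.cong[OF refl])
    fix b assume "b \<in> outside a"
    then have "b \<in> \<Sigma>" "fst b \<noteq> fst a" unfolding mem_outside by auto
    then show "limit_prob [a, b] = hit_prob a * rate b"
      using limit_prob_Cons[OF a, of "[b]"] by (simp add: rate_eq)
  qed
  finally show ?thesis by (simp add: sum_distrib_left)
qed

lemma rate_nonneg: "a \<in> \<Sigma> \<Longrightarrow> 0 \<le> rate a"
  by (simp add: rate_eq limit_prob_def)

text \<open>Some letter \<open>b\<close> has positive rate since the total is 1. As hitting
  probabilities are positive, \<open>rate_hit_prob\<close> passes positivity to every letter of
  another index, and through one such letter \<open>c\<close> back to the letters with the index of
  \<open>b\<close>.\<close>

lemma rate_in_open_simplex: "rate \<in> open_simplex \<Sigma>"
proof -
  have sum1: "sum rate \<Sigma> = 1"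
    using sum_limit_prob_Nil by (simp add: rate_eq)
  have outside_pos: "0 < sum rate (outside c)" if "b \<in> outside c" "0 < rate b" for b c
    using that by (intro sum_pos2[of _ b]) (auto intro: rate_nonneg)
  have "\<exists>b\<in>\<Sigma>. rate b \<noteq> 0"
    by (rule ccontr) (use sum1 in simp)
  then obtain b where b: "b \<in> \<Sigma>" "0 < rate b"
    using rate_nonneg by force
  have "0 < rate a" if a: "a \<in> \<Sigma>" for a
  proof -
    have "0 < sum rate (outside a)"
    proof (cases "fst b = fst a")
      case False
      then have "b \<in> outside a" using b(1) unfolding mem_outside by blast
      then show ?thesis using outside_pos b(2) by blast
    next
      case True
      obtain c where "c \<in> outside a" using exists_outside by blast
      then have c: "c \<in> \<Sigma>" "fst c \<noteq> fst a" unfolding mem_outside by auto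
      then have "b \<in> outside c" using b(1) True unfolding mem_outside by auto
      then have "0 < rate c"
        using rate_hit_prob[OF c(1)] hit_prob_positive[OF c(1)] outside_pos b(2) by simp
      then show ?thesis using outside_pos \<open>c \<in> outside a\<close> by blast
    qed
    then show ?thesis using rate_hit_prob[OF a] hit_prob_positive[OF a] by simp
  qed
  then show ?thesis using sum1 by (simp add: open_simplex_def rate_def)
qed

lemma hit_prob_eq: "a \<in> \<Sigma> \<Longrightarrow> hit_prob a = rate a / sum rate (outside a)"
  using rate_hit_prob[of a] open_simplex_outside_positive[OF rate_in_open_simplex, of a]
  by (simp add: field_simps)

lemma traffic_equations_rate: "traffic_equations I G \<mu> rate"
  unfolding traffic_equations_iff
proof
  fix a assume a: "a \<in> \<Sigma>"
  have "rate a = \<P>(\<omega> in P. eventually_prefix [a] \<omega>)"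
    using a by (simp add: rate_eq limit_prob_def)
  also have "\<dots> = (\<Sum>u\<in>\<Sigma>. pmf \<mu> u * \<P>(\<omega> in P. \<forall>\<^sub>F n in sequentially. prefix [a] ([u] \<odot> pos n \<omega>)))"
  proof (rule prob_first_step)
    fix u \<omega> assume "u \<in> \<Sigma>" "\<omega> \<in> letter_seqs"
    from pos_case_nat[OF this]
    show "eventually_prefix [a] (case_nat u \<omega>) \<longleftrightarrow> (\<forall>\<^sub>F n in sequentially. prefix [a] ([u] \<odot> pos n \<omega>))"
      unfolding eventually_prefix_shift[of "[a]" _ 1] plus_1_eq_Suc by (simp only:)
  next
    show "Measurable.pred P (\<lambda>\<omega>. \<forall>\<^sub>F n in sequentially. prefix [a] ([u] \<odot> pos n \<omega>))" for u
      unfolding eventually_sequentially by measurable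
  qed measurable
  also have "\<dots> = (\<Sum>u\<in>\<Sigma>. pmf \<mu> u *
      (if u = a then sum rate (outside a)
       else if fst u = fst a then rate (quot u a)
       else rate (inv_letter u) / sum rate (outside u) * rate a))"
  proof (intro sum.cong refl arg_cong2[where f = "(*)"])
    fix u assume u: "u \<in> \<Sigma>"
    \<comment> \<open>The event after a first increment \<open>u\<close> is rewritten pointwise
      along trajectories of reduced words. \<open>R\<close> will be the condition from the prefix
      lemma for the case at hand.\<close>
    have cong: "\<P>(\<omega> in P. \<forall>\<^sub>F n in sequentially. prefix [a] ([u] \<odot> pos n \<omega>)) = \<P>(\<omega> in P. \<forall>\<^sub>F n in sequentially. R (pos n \<omega>))"
      if "\<And>w. w \<in> L \<Longrightarrow> prefix [a] ([u] \<odot> w) \<longleftrightarrow> R w" for R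
    proof -
      have "(\<forall>\<^sub>F n in sequentially. prefix [a] ([u] \<odot> pos n \<omega>)) \<longleftrightarrow> (\<forall>\<^sub>F n in sequentially. R (pos n \<omega>))"
        if "\<omega> \<in> letter_seqs" for \<omega>
        using \<open>\<And>w. w \<in> L \<Longrightarrow> prefix [a] ([u] \<odot> w) \<longleftrightarrow> R w\<close>[OF pos_closed[OF that]] by (simp only:)
      then show ?thesis by (intro arg_cong[of _ _ "measure P"]) auto
    qed
    show "\<P>(\<omega> in P. \<forall>\<^sub>F n in sequentially. prefix [a] ([u] \<odot> pos n \<omega>)) =
      (if u = a then sum rate (outside a)
       else if fst u = fst a then rate (quot u a)
       else rate (inv_letter u) / sum rate (outside u) * rate a)"
    proof (cases "u = a")
      case True
      have "\<P>(\<omega> in P. \<forall>\<^sub>F n in sequentially. prefix [a] ([u] \<odot> pos n \<omega>)) = (\<Sum>b\<in>outside a. limit_prob [b])"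
        unfolding sum_limit_prob_not_like[OF a, symmetric]
        by (rule cong) (use prefix_single_mult_self[OF a] True in blast)
      also have "\<dots> = sum rate (outside a)"
        by (rule sum.cong) (auto simp: rate_eq)
      finally show ?thesis using True by simp
    next
      case neq: False
      show ?thesis
      proof (cases "fst u = fst a")
        case True
        have "\<P>(\<omega> in P. \<forall>\<^sub>F n in sequentially. prefix [a] ([u] \<odot> pos n \<omega>)) = limit_prob [quot u a]"
          unfolding limit_prob_def eventually_prefix_def
          by (rule cong) (rule prefix_single_mult_like[OF a u True neq])
        then show ?thesis using True neq rate_eq[OF quot_closed[OF a u True neq]] by simp
      next
        case False
        then have u_out: "u \<in> outside a" using u unfolding mem_outside by blast
        \<comment> \<open>The remaining walk has to converge to a word that starts with the inverse
          of \<open>u\<close> followed by \<open>a\<close>. \<open>limit_prob_Cons\<close>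
          factorises this probability into the product in the third term.\<close>
        have "\<P>(\<omega> in P. \<forall>\<^sub>F n in sequentially. prefix [a] ([u] \<odot> pos n \<omega>)) = limit_prob [inv_letter u, a]"
          unfolding limit_prob_def eventually_prefix_def
          by (rule cong) (rule prefix_single_mult_outside[OF a u_out])
        also have "\<dots> = hit_prob (inv_letter u) * rate a"
          using limit_prob_Cons[of "inv_letter u" "[a]"] u False a by (simp add: rate_eq)
        also have "\<dots> = rate (inv_letter u) / sum rate (outside u) * rate a"
          using hit_prob_eq[of "inv_letter u"] u outside_cong[of "inv_letter u" u] by simp
        finally show ?thesis using neq False by simp
      qed
    qed
  qed
  finally show "rate a = (\<Sum>u\<in>\<Sigma>. pmf \<mu> u *
      (if u = a then sum rate (outside a)
       else if fst u = fst a then rate (quot u a)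
       else rate (inv_letter u) / sum rate (outside u) * rate a))" .
qed

lemma traffic_equations_unique:
  assumes "x \<in> open_simplex \<Sigma>" "traffic_equations I G \<mu> x"
  shows "x = rate"
proof (rule open_simplex_eqI[OF rate_in_open_simplex assms(1), symmetric])
  show "rate a / sum rate (outside a) \<le> x a / sum x (outside a)" if "a \<in> \<Sigma>" for a
    using hit_prob_le[OF assms that] hit_prob_eq[OF that] by simp
qed

lemma limit_prob_eq:
  "u \<in> L \<Longrightarrow> u \<noteq> [] \<Longrightarrow>
    limit_prob u = (\<Prod>a\<leftarrow>butlast u. rate a / sum rate (outside a)) * rate (last u)"
proof (induction u)
  case (Cons a u)
  then have a: "a \<in> \<Sigma>" "u \<in> L" "u \<noteq> [] \<Longrightarrow> fst (hd u) \<noteq> fst a" by (auto simp: reduced_Cons)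
  show ?case
  proof (cases "u = []")
    case True
    then show ?thesis using a by (simp add: rate_eq)
  next
    case False
    then show ?thesis
      using Cons.IH a limit_prob_Cons[OF a(1) False a(3)[OF False]] hit_prob_eq[OF a(1)] by simp
  qed
qed simp

end


section \<open>The harmonic measure\<close>

context transient_free_product_random_walk
begin

lemma AE_converges: "AE \<omega> in P. \<exists>\<xi>. converges_to \<omega> \<xi>"
  using AE_eventually_prefix by (rule AE_mp) (simp add: converges_to_iff_eventually_prefix)

text \<open>An event of probability 1 is nonempty, so some trajectory converges, and its limit is an
  infinite reduced word.\<close>

lemma infinite_words_nonempty: "infinite_words I G \<noteq> {}"
proof -
  have "AE \<omega> in P. \<omega> \<in> space P \<and> (\<exists>\<xi>. converges_to \<omega> \<xi>)"
    using AE_converges AE_space by eventually_elim blast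
  from eventually_happens'[OF W.P.ae_filter_bot this]
  obtain \<omega> \<xi> where "\<omega> \<in> letter_seqs" "converges_to \<omega> \<xi>" by auto
  then show ?thesis using converges_to_infinite_words by blast
qed

text \<open>On the null set without a limit the value is a fixed infinite reduced word, so that the
  map lands in \<open>infinite_words I G\<close> everywhere, as measurability into
  \<open>infinite_word_space I G\<close> demands.\<close>

definition limit_word :: "(nat \<Rightarrow> 'i \<times> 'a) \<Rightarrow> nat \<Rightarrow> 'i \<times> 'a" where
  "limit_word \<omega> = (if \<exists>\<xi>. converges_to \<omega> \<xi> then SOME \<xi>. converges_to \<omega> \<xi>
     else SOME \<xi>. \<xi> \<in> infinite_words I G)"

lemma converges_to_limit_word: "\<exists>\<xi>. converges_to \<omega> \<xi> \<Longrightarrow> converges_to \<omega> (limit_word \<omega>)"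
  unfolding limit_word_def by (simp add: someI_ex)

lemma limit_word_infinite_words: "\<omega> \<in> letter_seqs \<Longrightarrow> limit_word \<omega> \<in> infinite_words I G"
  using converges_to_limit_word[of \<omega>] converges_to_infinite_words[of \<omega>] infinite_words_nonempty
  by (cases "\<exists>\<xi>. converges_to \<omega> \<xi>") (auto simp: limit_word_def some_in_eq)

lemma infinite_words_letter_seqs: "infinite_words I G \<subseteq> letter_seqs"
proof
  fix \<xi> assume \<xi>: "\<xi> \<in> infinite_words I G"
  have "\<xi> k \<in> \<Sigma>" for k
  proof -
    have "map \<xi> [0..<Suc k] \<in> L" using \<xi> unfolding infinite_words_def by blast
    then show ?thesis unfolding reduced_words_def by auto
  qed
  then show "\<xi> \<in> letter_seqs" by simp
qed

lemma space_infinite_word_space [simp]: "space (infinite_word_space I G) = infinite_words I G"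
  using infinite_words_letter_seqs
  by (auto simp: infinite_word_space_def space_restrict_space space_PiM PiE_UNIV_domain)

text \<open>Each coordinate has values in a finite set, so it suffices to express the event that
  coordinate \<open>k\<close> equals \<open>a\<close> by the measurable events
  \<open>eventually_prefix\<close>.\<close>

lemma measurable_limit_word [measurable]: "limit_word \<in> measurable P (infinite_word_space I G)"
  unfolding infinite_word_space_def
proof (rule measurable_restrict_space2)
  show "limit_word \<in> space P \<rightarrow> infinite_words I G"
    using limit_word_infinite_words by simp
  let ?W = "\<lambda>k. {u. set u \<subseteq> \<Sigma> \<and> length u = k}"
  have fin [simp]: "finite (?W k)" for k
    by (rule finite_lists_length_eq) simp
  \<comment> \<open>Convergence, with the candidate prefixes of each length confined to a finite
    set. This turns it into a countable combination of measurable events.\<close>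
  define good where "good \<omega> \<longleftrightarrow> (\<forall>k. \<exists>u\<in>?W k. eventually_prefix u \<omega>)" for \<omega>
  have good: "good \<omega> \<longleftrightarrow> (\<exists>\<xi>. converges_to \<omega> \<xi>)" if "\<omega> \<in> letter_seqs" for \<omega>
  proof -
    have "set u \<subseteq> \<Sigma>" if "eventually_prefix u \<omega>" for u
      using eventually_prefix_reduced[OF \<open>\<omega> \<in> letter_seqs\<close> that]
      unfolding reduced_words_def by blast
    then show ?thesis
      unfolding good_def converges_to_iff_eventually_prefix by blast
  qed
  have [measurable]: "Measurable.pred P good"
    unfolding good_def by (intro pred_intros_countable pred_intros_finite fin measurable_eventually_prefix)
  show "limit_word \<in> measurable P (\<Pi>\<^sub>M n\<in>UNIV. count_space \<Sigma>)"
  proof (rule measurable_PiM_single')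
    fix k :: nat
    show "(\<lambda>\<omega>. limit_word \<omega> k) \<in> measurable P (count_space \<Sigma>)"
      unfolding measurable_count_space_eq2[OF finite_alphabet]
    proof (intro conjI ballI)
      show "(\<lambda>\<omega>. limit_word \<omega> k) \<in> space P \<rightarrow> \<Sigma>"
        using limit_word_infinite_words infinite_words_letter_seqs by (auto simp: subset_iff Pi_iff)
      fix a
      \<comment> \<open>On converging trajectories some prefix of length \<open>k\<close> is
        followed by \<open>a\<close>. Elsewhere \<open>limit_word\<close> is the fixed default, so
        the second disjunct involves a constant.\<close>
      let ?R = "\<lambda>\<omega>. good \<omega> \<and> (\<exists>u\<in>?W k. eventually_prefix (u @ [a]) \<omega>)
        \<or> \<not> good \<omega> \<and> (SOME \<xi>. \<xi> \<in> infinite_words I G) k = a"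
      have "limit_word \<omega> k = a \<longleftrightarrow> ?R \<omega>" if \<omega>: "\<omega> \<in> letter_seqs" for \<omega>
      proof (cases "good \<omega>")
        case True
        then have c: "converges_to \<omega> (limit_word \<omega>)"
          using good[OF \<omega>] converges_to_limit_word by blast
        have "limit_word \<omega> \<in> letter_seqs"
          using limit_word_infinite_words[OF \<omega>] infinite_words_letter_seqs by blast
        then have "map (limit_word \<omega>) [0..<k] \<in> ?W k" by auto
        moreover have "limit_word \<omega> \<in> cylinder (u @ [a]) \<longleftrightarrow> u = map (limit_word \<omega>) [0..<k] \<and> limit_word \<omega> k = a"
          if "length u = k" for u
          using that by (auto simp: cylinder_def)
        ultimately show ?thesis
          using True unfolding converges_to_prefix_iff[OF c] by blast
      next
        case False
        then show ?thesis using good[OF \<omega>] by (simp add: limit_word_def)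
      qed
      then have "(\<lambda>\<omega>. limit_word \<omega> k) -` {a} \<inter> space P = {\<omega> \<in> letter_seqs. ?R \<omega>}"
        by auto
      moreover have "Measurable.pred P ?R"
        by (intro pred_intros_logic pred_intros_finite fin measurable_eventually_prefix) measurable
      ultimately show "(\<lambda>\<omega>. limit_word \<omega> k) -` {a} \<inter> space P \<in> sets P"
        using pred_event by simp
    qed
  next
    show "(\<lambda>\<omega> i. limit_word \<omega> i) \<in> space P \<rightarrow> (\<Pi>\<^sub>E i\<in>UNIV. space (count_space \<Sigma>))"
      using limit_word_infinite_words infinite_words_letter_seqs
      by (auto simp: subset_iff Pi_iff PiE_UNIV_domain)
  qed
qed

definition harmonic :: "(nat \<Rightarrow> 'i \<times> 'a) measure" where
  "harmonic = distr P (infinite_word_space I G) limit_word"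

text \<open>Limits are unique, so every version of the limit on \<open>N\<close> agrees almost
  surely with \<open>limit_word\<close> applied to \<open>T\<close>. All versions therefore share
  one law, which is \<open>harmonic\<close> because \<open>T\<close> has law
  \<open>P\<close>.\<close>

lemma is_harmonic_measure_iff:
  assumes T [measurable]: "T \<in> measurable N P" and law: "distr N P T = P"
    and X: "AE \<omega> in N. \<forall>n. X n \<omega> = pos n (T \<omega>)"
  shows "is_harmonic_measure I G N X \<nu> \<longleftrightarrow> \<nu> = harmonic"
proof -
  have conv: "AE \<omega> in N. converges_to (T \<omega>) (limit_word (T \<omega>))"
  proof -
    have "AE \<omega> in distr N P T. converges_to \<omega> (limit_word \<omega>)"
      unfolding law using AE_converges by (rule AE_mp) (simp add: converges_to_limit_word)
    then show ?thesis by (rule AE_distrD[OF T])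
  qed
  have X_conv: "AE \<omega> in N. filterlim (\<lambda>n. common_prefix_length (X n \<omega>) (\<xi> \<omega>)) at_top sequentially \<longleftrightarrow>
      \<xi> \<omega> = limit_word (T \<omega>)" for \<xi>
    using X conv
  proof eventually_elim
    case (elim \<omega>)
    then have "filterlim (\<lambda>n. common_prefix_length (X n \<omega>) (\<xi> \<omega>)) at_top sequentially \<longleftrightarrow>
        converges_to (T \<omega>) (\<xi> \<omega>)"
      unfolding converges_to_iff by simp
    also have "\<dots> \<longleftrightarrow> \<xi> \<omega> = limit_word (T \<omega>)"
      using elim(2) converges_to_unique by metis
    finally show ?case .
  qed
  have lim: "(\<lambda>\<omega>. limit_word (T \<omega>)) \<in> measurable N (infinite_word_space I G)"
    by measurable
  have harmonic: "distr N (infinite_word_space I G) (\<lambda>\<omega>. limit_word (T \<omega>)) = harmonic"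
    unfolding harmonic_def by (subst law[symmetric]) (simp add: distr_distr comp_def)
  show ?thesis
  proof
    assume "is_harmonic_measure I G N X \<nu>"
    then obtain \<xi> where \<xi>: "\<xi> \<in> measurable N (infinite_word_space I G)"
      "AE \<omega> in N. filterlim (\<lambda>n. common_prefix_length (X n \<omega>) (\<xi> \<omega>)) at_top sequentially"
      "\<nu> = distr N (infinite_word_space I G) \<xi>"
      unfolding is_harmonic_measure_def by blast
    have "AE \<omega> in N. \<xi> \<omega> = limit_word (T \<omega>)"
      using \<xi>(2) X_conv[of \<xi>] by eventually_elim blast
    then show "\<nu> = harmonic"
      unfolding \<xi>(3) harmonic[symmetric] by (intro distr_cong_AE \<xi>(1) lim) auto
  next
    assume "\<nu> = harmonic"
    moreover have "AE \<omega> in N. filterlim (\<lambda>n. common_prefix_length (X n \<omega>) (limit_word (T \<omega>))) at_top sequentially"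
      using X_conv[of "\<lambda>\<omega>. limit_word (T \<omega>)"] by eventually_elim blast
    ultimately show "is_harmonic_measure I G N X \<nu>"
      unfolding is_harmonic_measure_def using lim harmonic
      by (intro bexI[of _ "\<lambda>\<omega>. limit_word (T \<omega>)"]) auto
  qed
qed

lemma cylinder_event: "cylinder u \<inter> infinite_words I G \<in> sets (infinite_word_space I G)"
proof -
  have comp: "(\<lambda>\<xi>. \<xi> k) \<in> measurable (infinite_word_space I G) (count_space \<Sigma>)" for k
    unfolding infinite_word_space_def
    by (rule measurable_restrict_space1) (rule measurable_component_singleton, simp)
  have "Measurable.pred (infinite_word_space I G) (\<lambda>\<xi>. \<xi> k = c)" for k c
    using measurable_compose[OF comp, of "\<lambda>a. a = c" "count_space UNIV"] by simp
  then have "Measurable.pred (infinite_word_space I G) (\<lambda>\<xi>. \<forall>k\<in>{..<length u}. \<xi> k = u ! k)"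
    by (intro pred_intros_finite) auto
  moreover have "cylinder u \<inter> infinite_words I G =
      {\<xi> \<in> space (infinite_word_space I G). \<forall>k\<in>{..<length u}. \<xi> k = u ! k}"
  proof -
    have "map \<xi> [0..<length u] = u \<longleftrightarrow> (\<forall>k\<in>{..<length u}. \<xi> k = u ! k)" for \<xi>
    proof
      assume m: "map \<xi> [0..<length u] = u"
      show "\<forall>k\<in>{..<length u}. \<xi> k = u ! k"
      proof
        fix k assume "k \<in> {..<length u}"
        then have "map \<xi> [0..<length u] ! k = \<xi> k" by simp
        then show "\<xi> k = u ! k" by (simp only: m)
      qed
    qed (auto intro: nth_equalityI)
    then show ?thesis unfolding cylinder_def space_infinite_word_space by blast
  qed
  ultimately show ?thesis unfolding pred_def by simp
qed

lemma markovian_multiplicative_harmonic: "markovian_multiplicative I G rate harmonic"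
  unfolding markovian_multiplicative_def
proof (intro conjI ballI impI)
  show "prob_space harmonic"
    unfolding harmonic_def by (rule W.P.prob_space_distr) measurable
  show "space harmonic = infinite_words I G" "sets harmonic = sets (infinite_word_space I G)"
    by (simp_all add: harmonic_def)
  fix u assume u: "u \<in> L" "u \<noteq> []"
  have "measure harmonic (cylinder u \<inter> infinite_words I G) =
      measure P (limit_word -` (cylinder u \<inter> infinite_words I G) \<inter> space P)"
    unfolding harmonic_def by (rule measure_distr[OF measurable_limit_word cylinder_event])
  also have "\<dots> = limit_prob u"
    unfolding limit_prob_def
  proof (rule W.P.finite_measure_eq_AE)
    show "AE \<omega> in P. \<omega> \<in> limit_word -` (cylinder u \<inter> infinite_words I G) \<inter> space P \<longleftrightarrow>
        \<omega> \<in> {\<omega> \<in> space P. eventually_prefix u \<omega>}"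
      using AE_converges
    proof (rule AE_mp, intro AE_I2 impI)
      fix \<omega> assume "\<omega> \<in> space P" "\<exists>\<xi>. converges_to \<omega> \<xi>"
      then show "\<omega> \<in> limit_word -` (cylinder u \<inter> infinite_words I G) \<inter> space P \<longleftrightarrow>
          \<omega> \<in> {\<omega> \<in> space P. eventually_prefix u \<omega>}"
        using converges_to_prefix_iff[OF converges_to_limit_word] limit_word_infinite_words by auto
    qed
    show "limit_word -` (cylinder u \<inter> infinite_words I G) \<inter> space P \<in> sets P"
      by (rule measurable_sets[OF measurable_limit_word cylinder_event])
  qed (use pred_event[OF measurable_eventually_prefix] in simp)
  finally show "measure harmonic (cylinder u \<inter> infinite_words I G) =
      (\<Prod>a\<leftarrow>butlast u. rate a / sum rate (outside a)) * rate (last u)"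
    using limit_prob_eq[OF u] by simp
qed

end

section \<open>Transfer from an arbitrary probability space\<close>

context free_product_random_walk
begin

text \<open>The increments are letters only almost surely, while \<open>P\<close> lives on sequences
  of letters. Values outside the alphabet are replaced by an arbitrary letter.\<close>

definition trim :: "'i \<times> 'a \<Rightarrow> 'i \<times> 'a" where
  "trim a = (if a \<in> \<Sigma> then a else SOME b. b \<in> \<Sigma>)"

lemma trim_closed: "trim a \<in> \<Sigma>"
proof -
  have "\<Sigma> \<noteq> {}" using exists_outside by blast
  then show ?thesis by (simp add: trim_def some_in_eq)
qed

lemma measurable_trim: "trim \<in> measurable (count_space UNIV) step_law"
  using trim_closed by simp

lemma distr_trim: "distr (measure_pmf \<mu>) step_law trim = step_law"
proof (rule measure_eqI)
  fix A assume "A \<in> sets (distr (measure_pmf \<mu>) step_law trim)"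
  then have A: "A \<subseteq> \<Sigma>" by (simp add: sets_step_law)
  then have fin: "finite A" by (rule finite_subset) simp
  have "emeasure (distr (measure_pmf \<mu>) step_law trim) A = emeasure (measure_pmf \<mu>) (trim -` A)"
    using A trim_closed by (subst emeasure_distr) (auto simp: sets_step_law)
  also have "\<dots> = emeasure (measure_pmf \<mu>) A"
    by (rule emeasure_eq_AE) (use set_pmf_mu in \<open>auto simp: AE_measure_pmf_iff trim_def\<close>)
  also have "\<dots> = (\<Sum>a\<in>A. ennreal (pmf \<mu> a))"
    by (simp add: emeasure_measure_pmf_finite[OF fin])
  also have "\<dots> = emeasure step_law A"
    unfolding step_law_def using A by (simp add: emeasure_point_measure_finite)
  finally show "emeasure (distr (measure_pmf \<mu>) step_law trim) A = emeasure step_law A" .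
qed simp

text \<open>Trimming preserves independence and gives each increment the law
  \<open>step_law\<close>, so the joint law is the product measure. Countably many null sets are
  discarded to identify the walk with \<open>pos\<close>.\<close>

lemma iid_seq_trim:
  assumes "prob_space N" and iid: "iid_seq N \<mu> x"
  defines "T \<equiv> (\<lambda>\<omega> n. trim (x n \<omega>))"
  shows "T \<in> measurable N P" "distr N P T = P"
    "AE \<omega> in N. \<forall>n. free_product_walk I G x n \<omega> = pos n (T \<omega>)"
proof -
  interpret N: prob_space N by fact
  have indep: "N.indep_vars (\<lambda>_. count_space UNIV) x UNIV"
    and law: "distr N (count_space UNIV) (x n) = measure_pmf \<mu>" for n
    using iid by (auto simp: iid_seq_def)
  have x: "x n \<in> measurable N (count_space UNIV)" for n
    using indep by (auto simp: N.indep_vars_def)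
  have trim_x: "(\<lambda>\<omega>. trim (x n \<omega>)) \<in> measurable N step_law" for n
    by (rule measurable_compose[OF x measurable_trim])
  then show T: "T \<in> measurable N P"
    unfolding T_def by (intro measurable_PiM_single') (auto simp: trim_closed PiE_UNIV_domain)
  have "N.indep_vars (\<lambda>_. step_law) (\<lambda>n \<omega>. trim (x n \<omega>)) UNIV"
    by (rule N.indep_vars_compose2[OF indep measurable_trim])
  then have "distr N P (\<lambda>\<omega>. \<lambda>n\<in>UNIV. trim (x n \<omega>)) = (\<Pi>\<^sub>M n\<in>UNIV. distr N step_law (\<lambda>\<omega>. trim (x n \<omega>)))"
    by (subst (asm) N.indep_vars_iff_distr_eq_PiM) (auto intro: trim_x)
  moreover have "distr N step_law (\<lambda>\<omega>. trim (x n \<omega>)) = step_law" for n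
    using distr_distr[OF measurable_trim x[of n]] law[of n] distr_trim by (simp add: comp_def)
  ultimately show "distr N P T = P" by (simp add: T_def restrict_def)
  have "AE \<omega> in N. x n \<omega> \<in> \<Sigma>" for n
  proof -
    have "AE a in distr N (count_space UNIV) (x n). a \<in> \<Sigma>"
      unfolding law using set_pmf_mu by (auto simp: AE_measure_pmf_iff)
    then show ?thesis by (rule AE_distrD[OF x])
  qed
  then have "AE \<omega> in N. \<forall>n. x n \<omega> \<in> \<Sigma>" by (simp add: AE_all_countable)
  then show "AE \<omega> in N. \<forall>n. free_product_walk I G x n \<omega> = pos n (T \<omega>)"
    by eventually_elim (simp add: free_product_walk_eq_pos T_def trim_def)
qed

lemma transient_iff:
  assumes "prob_space N" and "iid_seq N \<mu> x"
  shows "transient_walk (free_product I G) N (free_product_walk I G x) \<longleftrightarrow>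
    (AE \<omega> in P. finite {n. pos n \<omega> = []})"
proof -
  let ?T = "\<lambda>\<omega> n. trim (x n \<omega>)"
  note T = iid_seq_trim[OF assms]
  have "Measurable.pred P (\<lambda>\<omega>. finite {n. pos n \<omega> = []})"
    unfolding finite_nat_set_iff_bounded by simp measurable
  then have "(AE \<omega> in distr N P ?T. finite {n. pos n \<omega> = []}) \<longleftrightarrow> (AE \<omega> in N. finite {n. pos n (?T \<omega>) = []})"
    using pred_event by (intro AE_distr_iff T(1)) simp
  also have "\<dots> \<longleftrightarrow> (AE \<omega> in N. finite {n. free_product_walk I G x n \<omega> = []})"
  proof
    assume "AE \<omega> in N. finite {n. pos n (?T \<omega>) = []}"
    with T(3) show "AE \<omega> in N. finite {n. free_product_walk I G x n \<omega> = []}"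
      by eventually_elim (simp only:)
  next
    assume "AE \<omega> in N. finite {n. free_product_walk I G x n \<omega> = []}"
    with T(3) show "AE \<omega> in N. finite {n. pos n (?T \<omega>) = []}"
      by eventually_elim (simp only:)
  qed
  finally show ?thesis unfolding T(2) transient_walk_def one_H by (rule sym)
qed

end

theorem theorem3p5:
  fixes I :: "'i set" and G :: "'i \<Rightarrow> ('a, 'b) monoid_scheme"
    and \<mu> :: "('i \<times> 'a) pmf"
    and M :: "'w measure" and x :: "nat \<Rightarrow> 'w \<Rightarrow> 'i \<times> 'a"
  assumes "finite I" and "card I \<ge> 2"
    and "\<And>i. i \<in> I \<Longrightarrow> group (G i)"
    and "\<And>i. i \<in> I \<Longrightarrow> finite (carrier (G i))"
    and "\<And>i. i \<in> I \<Longrightarrow> card (carrier (G i)) > 1"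
    and "set_pmf \<mu> \<subseteq> alphabet I G"
    and "(\<Union>n\<in>{1..}. set_pmf (conv_power (free_product I G) (map_pmf (\<lambda>a. [a]) \<mu>) n))
           = carrier (free_product I G)"
    and "prob_space M" and "iid_seq M \<mu> x"
    and "transient_walk (free_product I G) M (free_product_walk I G x)"
  shows "(\<exists>!r. r \<in> open_simplex (alphabet I G) \<and> traffic_equations I G \<mu> r) \<and>
    (\<exists>!\<nu>. is_harmonic_measure I G M (free_product_walk I G x) \<nu>) \<and>
    (\<forall>r \<nu>. r \<in> open_simplex (alphabet I G) \<and> traffic_equations I G \<mu> r \<and>
       is_harmonic_measure I G M (free_product_walk I G x) \<nu> \<longrightarrow>
       markovian_multiplicative I G r \<nu>)"
proof -
  interpret free_product_random_walk I G \<mu>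
    by (intro free_product_random_walk.intro free_product_family.intro
        free_product_random_walk_axioms.intro assms)
  interpret transient_free_product_random_walk I G \<mu>
    by unfold_locales (use transient_iff[OF assms(8,9)] assms(10) in blast)
  note harmonic_iff = is_harmonic_measure_iff[OF iid_seq_trim[OF assms(8,9)]]
  \<comment> \<open>The admissible solutions are exactly \<open>rate\<close>, as the harmonic
    measures are exactly \<open>harmonic\<close>. All three claims then reduce to the multiplicative
    form of this one pair.\<close>
  have "r \<in> open_simplex (alphabet I G) \<and> traffic_equations I G \<mu> r \<longleftrightarrow> r = rate" for r
    using rate_in_open_simplex traffic_equations_rate traffic_equations_unique by blast
  then show ?thesis
    using harmonic_iff markovian_multiplicative_harmonic by auto
qed

end
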